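(* Let $T>0$ and let $a\colon\mathbb{R}\to\mathbb{R}$ be a locally integrable $T$-periodic function such that $\int_0^T a(t)\,dt<0$ and such that there exist $m\ge1$ intervals $I_1^+,\dots,I_m^+$, closed and pairwise disjoint in the quotient space $\mathbb{R}/T\mathbb{Z}$, with $a(t)\ge0$ for a.e. $t\in I_i^+$ and $a\not\equiv0$ on $I_i^+$ for $i=1,\dots,m$, and $a(t)\le0$ for a.e. $t\in(\mathbb{R}/T\mathbb{Z})\setminus\bigcup_{i=1}^m I_i^+$. Let $g\colon[0,+\infty)\to[0,+\infty)$ be a continuous function with $g(0)=0$ and $g(u)>0$ for $u>0$. Suppose that at least one of the following holds: (1) $\lim_{u\to0^+}g(u)/u=0$ and $\lim_{u\to0^+,\ \omega\to1}g(\omega u)/g(u)=1$; (2) there exists $\varepsilon>0$ such that $g\in\mathcal{C}^1([0,\varepsilon))$ and $g'(0)=0$. Suppose further that $g$ is non-decreasing in a right neighborhood of $0$ and that there exist $p>1$ and $c_p\in(0,+\infty)$ such that $\lim_{u\to0^+}g(u)/u^p=c_p$. Let $\rho^*,\lambda^*$ be as described in the context, and let $\{u_{s,\lambda}(t)\}_{\lambda>\lambda^*}$ be a family of positive $T$-periodic solutions to $$\left(\frac{u'}{\sqrt{1-(u')^2}}\right)'+\lambda a(t)g(u)=0$$ with $\|u_{s,\lambda}\|_\infty<\rho^*$. Then it holds that $$u_{s,\lambda}\to0\quad\text{in }\mathcal{C}^1_T,\text{ as }\lambda\to+\infty,$$ and, for a suitable constant $C>0$, $$|u_{s,\lambda}''(t)|\le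 C|a(t)|,\quad\text{for a.e. }t\in\mathbb{R}\text{ and for all }\lambda>\lambda^*.$$
   Context: Set $\varphi(\xi)=\xi/\sqrt{1-\xi^2}$ for $\xi\in(-1,1)$. A solution of $(\varphi(u'))'+\lambda a(t)g(u)=0$ is a continuously differentiable function $u$ (with $|u'|<1$) such that $t\mapsto\varphi(u'(t))$ is locally absolutely continuous and the equation holds for almost every $t$ (then $u'$ is locally absolutely continuous, so $u''$ exists a.e.). A $T$-periodic solution is a solution defined on $\mathbb{R}$ with $u(t+T)=u(t)$ for all $t$; it is positive if $u(t)>0$ for all $t\in\mathbb{R}$. $\|\cdot\|_\infty$ is the sup-norm. $\mathcal{C}^1_T$ is the space of $T$-periodic $\mathcal{C}^1$ functions with the usual norm. "$a\not\equiv0$ on an interval" means $a$ is not a.e. zero there. Limits as $u\to0^+$ and $\omega\to1$ are joint limits. Constants $\rho^*,\lambda^*$: write $I_i^+=[\sigma_i,\tau_i]$ and $|I_i^+|=\tau_i-\sigma_i$. The number $\rho^*>0$ is fixed so that $\rho^*<|I_i^+|/4$ and $\int_{\sigma_i+2\rho^*}^{\tau_i-2\rho^*}a(t)\,dt>0$ for every $i=1,\dots,m$, and $$\lambda^*=\max_{i=1,\dots,m}\frac{2\varphi(1/2)}{\min\{g(u)\colon u\in[2(\rho^* )^2/|I_i^+|,\rho^*]\}\int_{\sigma_i+2\rho^*}^{\tau_i-2\rho^*}a(t)\,dt}.$$ (With this choice, for every $\lambda>\lambda^*$ there exists at least one positive $T$-periodic solution with sup-norm smaller than $\rho^*$.)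 *)

theory Defs
  imports "HOL-Analysis.Analysis"
begin

definition phi :: "real \<Rightarrow> real" where
  "phi \<xi> = \<xi> / sqrt (1 - \<xi>\<^sup>2)"

(* Absolute continuity of a function on a compact interval in the usual epsilon-delta sense;
   a pair (\<alpha>, \<beta>) in P stands for the interval with these endpoints, and the intervals of P
   are non-overlapping. *)
definition abs_cont_on :: "(real \<Rightarrow> real) \<Rightarrow> real \<Rightarrow> real \<Rightarrow> bool" where
  "abs_cont_on f x y \<longleftrightarrow>
    (\<forall>e>0. \<exists>d>0. \<forall>P :: (real \<times> real) set.
       finite P \<longrightarrow>
       (\<forall>(\<alpha>, \<beta>)\<in>P. x \<le> \<alpha> \<and> \<alpha> \<le> \<beta> \<and> \<beta> \<le> y) \<longrightarrow>
       disjoint_family_on (\<lambda>(\<alpha>, \<beta>). {\<alpha><..<\<beta>}) P \<longrightarrow>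
       (\<Sum>(\<alpha>, \<beta>)\<in>P. \<beta> - \<alpha>) < d \<longrightarrow>
       (\<Sum>(\<alpha>, \<beta>)\<in>P. \<bar>f \<beta> - f \<alpha>\<bar>) < e)"

definition locally_abs_cont :: "(real \<Rightarrow> real) \<Rightarrow> bool" where
  "locally_abs_cont f \<longleftrightarrow> (\<forall>x y. abs_cont_on f x y)"

definition periodic_with :: "real \<Rightarrow> (real \<Rightarrow> real) \<Rightarrow> bool" where
  "periodic_with T f \<longleftrightarrow> (\<forall>t. f (t + T) = f t)"

definition locally_integrable :: "(real \<Rightarrow> real) \<Rightarrow> bool" where
  "locally_integrable f \<longleftrightarrow> (\<forall>x y. f absolutely_integrable_on {x..y})"

(* The preimage in the real line of the image of S in the quotient R/TZ. *)
definition saturation :: "real \<Rightarrow> real set \<Rightarrow> real set" where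
  "saturation T S = {t + of_int k * T | t k. t \<in> S}"

definition is_solution :: "(real \<Rightarrow> real) \<Rightarrow> (real \<Rightarrow> real) \<Rightarrow> real \<Rightarrow> (real \<Rightarrow> real) \<Rightarrow> bool" where
  "is_solution a g lam u \<longleftrightarrow>
     u C1_differentiable_on UNIV \<and>
     (\<forall>t. \<bar>deriv u t\<bar> < 1) \<and>
     locally_abs_cont (\<lambda>t. phi (deriv u t)) \<and>
     (AE t in lebesgue.
        \<exists>d. ((\<lambda>s. phi (deriv u s)) has_real_derivative d) (at t) \<and> d + lam * a t * g (u t) = 0)"

(* The nonlinearity g is only meaningful on the half-line [0, \<infinity>), which contains the range
   of a positive solution. *)
definition positive_periodic_solution ::
    "real \<Rightarrow> (real \<Rightarrow> real) \<Rightarrow> (real \<Rightarrow> real) \<Rightarrow> real \<Rightarrow> (real \<Rightarrow> real) \<Rightarrow> bool" where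
  "positive_periodic_solution T a g lam u \<longleftrightarrow>
     is_solution a g lam u \<and> periodic_with T u \<and> (\<forall>t. u t > 0)"

(* Both norms below are only used for bounded functions (for which the supremum is the true one). *)
definition sup_norm :: "(real \<Rightarrow> real) \<Rightarrow> real" where
  "sup_norm f = (SUP t. \<bar>f t\<bar>)"

definition C1_norm :: "(real \<Rightarrow> real) \<Rightarrow> real" where
  "C1_norm f = sup_norm f + sup_norm (deriv f)"

definition admissible_rho ::
    "(real \<Rightarrow> real) \<Rightarrow> nat \<Rightarrow> (nat \<Rightarrow> real) \<Rightarrow> (nat \<Rightarrow> real) \<Rightarrow> real \<Rightarrow> bool" where
  "admissible_rho a m \<sigma> \<tau> \<rho> \<longleftrightarrow>
     \<rho> > 0 \<and>
     (\<forall>i\<in>{1..m}. \<rho> < (\<tau> i - \<sigma> i) / 4 \<and> integral {\<sigma> i + 2 * \<rho>..\<tau> i - 2 * \<rho>} a > 0)"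

(* The infimum is a minimum, because g is continuous and (for admissible \<rho>) the interval is
   nonempty and compact. *)
definition lambda_star ::
    "(real \<Rightarrow> real) \<Rightarrow> (real \<Rightarrow> real) \<Rightarrow> nat \<Rightarrow> (nat \<Rightarrow> real) \<Rightarrow> (nat \<Rightarrow> real) \<Rightarrow> real \<Rightarrow> real" where
  "lambda_star a g m \<sigma> \<tau> \<rho> =
     Max ((\<lambda>i. 2 * phi (1/2) /
               ((INF u\<in>{2 * \<rho>\<^sup>2 / (\<tau> i - \<sigma> i)..\<rho>}. g u) *
                integral {\<sigma> i + 2 * \<rho>..\<tau> i - 2 * \<rho>} a)) ` {1..m})"

end

theory Submission
  imports Defs
begin

text \<open>
  Write \<open>F = \<phi>(u')\<close>, so that \<open>F' = - \<lambda> a g(u)\<close> almost everywhere. Everything rests on one estimate: if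
  \<open>M\<close> is the maximum of a solution with \<open>M < \<rho>\<close>, then \<open>\<lambda> M\<^sup>p \<le> K M\<close> with \<open>K\<close> independent of
  \<open>\<lambda>\<close> and of the solution.

  The maximum is attained in some interval \<open>[\<sigma>, \<tau>]\<close> on which \<open>a \<ge> 0\<close>, because outside these intervals
  \<open>u\<close> is convex: going left from a maximum point, \<open>u\<close> cannot decrease before such an interval is met
  (lemma \<open>max_attained_on_nonneg_intervals\<close>). On \<open>[\<sigma>, \<tau>]\<close> the solution is concave and positive. Hence on
  the core \<open>[\<sigma> + 2\<rho>, \<tau> - 2\<rho>]\<close> it is at least a fixed fraction of \<open>M\<close>, while its slopes at the two ends of
  the core are at most \<open>M / (2\<rho>) \<le> 1/2\<close> in the directions that matter (lemma \<open>concave_hump_estimates\<close>).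
  Integrating the equation over the core bounds \<open>\<lambda> \<integral> a g(u)\<close> by the drop of \<open>F\<close>, which is at most
  \<open>2 M / \<rho>\<close>; as \<open>g\<close> is comparable to the power \<open>p\<close> on \<open>(0, \<rho>]\<close> (lemma \<open>power_growth_two_sided\<close>), the left
  side is at least a constant times \<open>\<lambda> M\<^sup>p\<close> (lemma \<open>hump_height_estimate\<close>).

  Since \<open>p > 1\<close>, the estimate forces \<open>M \<rightarrow> 0\<close> as \<open>\<lambda> \<rightarrow> \<infinity>\<close>. It also bounds \<open>\<lambda> g(u)\<close> by a multiple of \<open>M\<close>
  everywhere, and integrating from a maximum point bounds \<open>u'\<close> by a multiple of \<open>M\<close>, which is the convergence in \<open>C\<^sup>1\<close>.
  Finally \<open>\<bar>u''\<bar> \<le> \<lambda> g(u) \<bar>a\<bar>\<close>, because the inverse of \<open>\<phi>\<close> has slope at most \<open>1\<close>, and \<open>\<lambda> g(u)\<close> is bounded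
  because \<open>M < \<rho>\<close>.

  Two points of real analysis need an argument of their own. The equation holds only almost everywhere, so its
  integrated form needs the fundamental theorem of calculus for absolutely continuous functions
  (lemma \<open>fundamental_theorem_of_calculus_abs_cont\<close>). And the bound on \<open>u''\<close> is required off one null set
  serving all of the uncountably many \<open>\<lambda>\<close> at once; this works because the exceptional set can be chosen from
  \<open>a\<close> alone (lemma \<open>AE_derivative_of_weighted_primitive\<close>).
\<close>

section \<open>Absolutely continuous functions as integrals of their derivative\<close>

text \<open>
  The form of absolute continuity that a gauge integral can use. Degenerate cells contribute nothing and are
  discarded first: only nondegenerate cells are determined by their pair of end points.
\<close>

lemma abs_cont_on_tagged_small:
  fixes F :: "real \<Rightarrow> real"
  assumes ac: "abs_cont_on F x y" and e: "e > 0"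
  obtains d where "d > 0"
    "\<And>p. \<lbrakk>p tagged_partial_division_of {x..y}; (\<Sum>(t, K)\<in>p. measure lborel K) < d\<rbrakk>
        \<Longrightarrow> (\<Sum>(t, K)\<in>p. \<bar>F (Sup K) - F (Inf K)\<bar>) < e"
proof -
  obtain d where d: "d > 0"
    and dP: "\<And>P :: (real \<times> real) set. \<lbrakk>finite P; \<forall>(\<alpha>, \<beta>)\<in>P. x \<le> \<alpha> \<and> \<alpha> \<le> \<beta> \<and> \<beta> \<le> y;
              disjoint_family_on (\<lambda>(\<alpha>, \<beta>). {\<alpha><..<\<beta>}) P; (\<Sum>(\<alpha>, \<beta>)\<in>P. \<beta> - \<alpha>) < d\<rbrakk>
              \<Longrightarrow> (\<Sum>(\<alpha>, \<beta>)\<in>P. \<bar>F \<beta> - F \<alpha>\<bar>) < e"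
    using ac e unfolding abs_cont_on_def by (metis (no_types, lifting))
  have "(\<Sum>(t, K)\<in>p. \<bar>F (Sup K) - F (Inf K)\<bar>) < e"
    if p: "p tagged_partial_division_of {x..y}" and small: "(\<Sum>(t, K)\<in>p. measure lborel K) < d" for p
  proof -
    define q where "q = {(t, K) \<in> p. Inf K < Sup K}"
    define ends where "ends = (\<lambda>(t :: real, K :: real set). (Inf K, Sup K))"
    have fin: "finite p" using p by (rule tagged_partial_division_ofD)
    have cell: "\<exists>\<alpha> \<beta>. K = {\<alpha>..\<beta>} \<and> \<alpha> \<le> \<beta> \<and> x \<le> \<alpha> \<and> \<beta> \<le> y" if tK: "(t, K) \<in> p" for t K
    proof -
      obtain \<alpha> \<beta> where K: "K = {\<alpha>..\<beta>}"
        using tagged_partial_division_ofD(4)[OF p tK] by (auto simp: box_real)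
      have "t \<in> K" "K \<subseteq> {x..y}" using tagged_partial_division_ofD(2,3)[OF p tK] by auto
      then show ?thesis using K by auto
    qed
    have apart: "{Inf K<..<Sup K} \<inter> {Inf K'<..<Sup K'} = {}"
      if in1: "(t, K) \<in> p" and in2: "(t', K') \<in> p" and ne: "(t, K) \<noteq> (t', K')" for t K t' K'
    proof -
      have "interior K \<inter> interior K' = {}"
        using tagged_partial_division_ofD(5)[OF p in1 in2 ne] .
      then show ?thesis using cell[OF in1] cell[OF in2] by auto
    qed
    have inj: "inj_on ends q"
    proof (rule inj_onI)
      fix k k' assume kk: "k \<in> q" "k' \<in> q" "ends k = ends k'"
      obtain t K t' K' where k: "k = (t, K)" and k': "k' = (t', K')" by fastforce
      \<comment> \<open>two nondegenerate cells with the same end points share their midpoint, so they are not disjoint\<close>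
      have "(Inf K + Sup K) / 2 \<in> {Inf K<..<Sup K} \<inter> {Inf K'<..<Sup K'}"
        using kk by (auto simp: q_def ends_def k k' field_simps)
      then have "{Inf K<..<Sup K} \<inter> {Inf K'<..<Sup K'} \<noteq> {}" by blast
      moreover have "(t, K) \<in> p" "(t', K') \<in> p" using kk by (auto simp: q_def k k')
      ultimately show "k = k'" using apart[of t K t' K'] unfolding k k' by blast
    qed
    have "(\<Sum>(t, K)\<in>p. \<bar>F (Sup K) - F (Inf K)\<bar>) = (\<Sum>(t, K)\<in>q. \<bar>F (Sup K) - F (Inf K)\<bar>)"
      by (rule sum.mono_neutral_right) (use fin cell in \<open>force simp: q_def\<close>)+
    also have "\<dots> = (\<Sum>(\<alpha>, \<beta>)\<in>ends ` q. \<bar>F \<beta> - F \<alpha>\<bar>)"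
      by (subst sum.reindex[OF inj]) (auto simp: ends_def split_def)
    also have "\<dots> < e"
    proof (rule dP)
      show "finite (ends ` q)" using fin by (auto simp: q_def intro: finite_subset)
      show "\<forall>(\<alpha>, \<beta>)\<in>ends ` q. x \<le> \<alpha> \<and> \<alpha> \<le> \<beta> \<and> \<beta> \<le> y"
        using cell by (fastforce simp: ends_def q_def)
      show "disjoint_family_on (\<lambda>(\<alpha>, \<beta>). {\<alpha><..<\<beta>}) (ends ` q)"
        unfolding disjoint_family_on_def
      proof (intro ballI impI)
        fix k k' assume "k \<in> ends ` q" "k' \<in> ends ` q" "k \<noteq> k'"
        then obtain t K t' K' where "(t, K) \<in> p" "(t', K') \<in> p" "(t, K) \<noteq> (t', K')"
            "k = (Inf K, Sup K)" "k' = (Inf K', Sup K')"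
          by (auto simp: ends_def q_def)
        then show "(case k of (\<alpha>, \<beta>) \<Rightarrow> {\<alpha><..<\<beta>}) \<inter> (case k' of (\<alpha>, \<beta>) \<Rightarrow> {\<alpha><..<\<beta>}) = {}"
          using apart by simp
      qed
      have "(\<Sum>(\<alpha>, \<beta>)\<in>ends ` q. \<beta> - \<alpha>) = (\<Sum>(t, K)\<in>q. Sup K - Inf K)"
        by (subst sum.reindex[OF inj]) (auto simp: ends_def split_def)
      also have "\<dots> = (\<Sum>(t, K)\<in>q. measure lborel K)"
        by (rule sum.cong) (use cell in \<open>force simp: q_def\<close>)+
      also have "\<dots> \<le> (\<Sum>(t, K)\<in>p. measure lborel K)"
        by (rule sum_mono2) (use fin in \<open>auto simp: q_def\<close>)
      finally show "(\<Sum>(\<alpha>, \<beta>)\<in>ends ` q. \<beta> - \<alpha>) < d" using small by simp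
    qed
    finally show ?thesis .
  qed
  then show ?thesis using d that by blast
qed

lemma tagged_content_le_measure:
  fixes U :: "real set"
  assumes p: "p tagged_partial_division_of {x..y}" and U: "U \<in> lmeasurable"
    and sub: "\<And>t K. (t, K) \<in> p \<Longrightarrow> K \<subseteq> U"
  shows "(\<Sum>(t, K)\<in>p. measure lborel K) \<le> measure lebesgue U"
proof -
  have div: "snd ` p division_of \<Union>(snd ` p)"
    using partial_division_of_tagged_division[OF p] .
  have "(\<Sum>(t, K)\<in>p. measure lborel K) = (\<Sum>K\<in>snd ` p. measure lborel K)"
  proof -
    have "sum (measure lborel) (snd ` p) = sum (measure lborel \<circ> snd) p"
    proof (rule sum.reindex_nontrivial)
      show "finite p" using p by (rule tagged_partial_division_ofD)
      fix k k' assume k: "k \<in> p" "k' \<in> p" "k \<noteq> k'" "snd k = snd k'"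
      then have "interior (snd k) = {}"
        using tagged_partial_division_ofD(5)[OF p, of "fst k" "snd k" "fst k'" "snd k'"]
        by (metis inf.idem prod.collapse)
      moreover obtain \<alpha> \<beta> where "snd k = cbox \<alpha> \<beta>"
        using tagged_partial_division_ofD(4)[OF p, of "fst k" "snd k"] k(1) by (metis prod.collapse)
      ultimately show "measure lborel (snd k) = 0" by (simp add: content_eq_0_interior)
    qed
    then show ?thesis by (simp add: split_def comp_def)
  qed
  also have "\<dots> = measure lebesgue (\<Union>(snd ` p))"
  proof -
    have "(\<Sum>K\<in>snd ` p. measure lborel K) = (\<Sum>K\<in>snd ` p. measure lebesgue K)"
      by (rule sum.cong) (use tagged_partial_division_ofD(4)[OF p] in \<open>force\<close>)+
    then show ?thesis using content_division[OF div] by simp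
  qed
  also have "\<dots> \<le> measure lebesgue U"
    by (rule measure_mono_fmeasurable)
       (use sub U lmeasurable_division[OF div] in \<open>force dest: fmeasurableD\<close>)+
  finally show ?thesis .
qed

lemma straddle_estimate:
  fixes F :: "real \<Rightarrow> real"
  assumes "(F has_real_derivative D) (at t)" and "e > 0"
  obtains d where "d > 0"
    "\<And>u v. \<lbrakk>u \<le> t; t \<le> v; u \<in> ball t d; v \<in> ball t d\<rbrakk> \<Longrightarrow> \<bar>F v - F u - (v - u) * D\<bar> \<le> e * (v - u)"
proof -
  obtain d where d: "d > 0" "\<And>s. \<bar>s - t\<bar> < d \<Longrightarrow> \<bar>F s - F t - D * (s - t)\<bar> \<le> e * \<bar>s - t\<bar>"
    using assms unfolding has_field_derivative_def has_derivative_at_alt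
    by (auto simp: mult.commute)
  have "\<bar>F v - F u - (v - u) * D\<bar> \<le> e * (v - u)"
    if "u \<le> t" "t \<le> v" "u \<in> ball t d" "v \<in> ball t d" for u v
  proof -
    have "\<bar>F v - F t - D * (v - t)\<bar> \<le> e * (v - t)" "\<bar>F u - F t - D * (u - t)\<bar> \<le> e * (t - u)"
      using d(2)[of v] d(2)[of u] that by (auto simp: dist_real_def abs_minus_commute)
    then show ?thesis by (simp add: abs_le_iff algebra_simps)
  qed
  then show ?thesis using d(1) that by blast
qed

text \<open>
  A Henstock-Kurzweil argument. At a tag where \<open>F\<close> is differentiable the gauge makes the increment of \<open>F\<close>
  over the cell nearly equal to the derivative times the length. The remaining tags lie in a null set; the gauge keeps
  their cells inside an open set of small measure, so absolute continuity makes the total increment over them small.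
\<close>

lemma fundamental_theorem_of_calculus_abs_cont:
  fixes F f :: "real \<Rightarrow> real"
  assumes xy: "x \<le> y" and ac: "abs_cont_on F x y"
    and der: "AE t in lebesgue. (F has_real_derivative f t) (at t)"
  shows "(f has_integral F y - F x) {x..y}"
proof -
  obtain N where N: "negligible N" and off: "\<And>t. t \<notin> N \<Longrightarrow> (F has_real_derivative f t) (at t)"
    using der by (auto simp: eventually_ae_filter_negligible)
  \<comment> \<open>with the value \<open>0\<close> on \<open>N\<close> a bad tag contributes only the increment of \<open>F\<close>\<close>
  define h where "h t = (if t \<in> N then 0 else f t)" for t
  have "(h has_integral F y - F x) {x..y}"
    unfolding has_integral_real
  proof (intro allI impI)
    fix e :: real assume e: "e > 0"
    \<comment> \<open>the summand \<open>1\<close> avoids a division by zero when \<open>x = y\<close>\<close>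
    define \<eta> where "\<eta> = e / (2 * (y - x + 1))"
    have \<eta>: "\<eta> > 0" and \<eta>_small: "\<eta> * (y - x) < e / 2"
      using e xy by (auto simp: \<eta>_def field_simps)
    obtain d where d: "d > 0"
      and dp: "\<And>p. \<lbrakk>p tagged_partial_division_of {x..y}; (\<Sum>(t, K)\<in>p. measure lborel K) < d\<rbrakk>
        \<Longrightarrow> (\<Sum>(t, K)\<in>p. \<bar>F (Sup K) - F (Inf K)\<bar>) < e / 2"
      using abs_cont_on_tagged_small[OF ac, of "e / 2"] e by auto
    obtain U where U: "open U" "N \<subseteq> U" "U \<in> lmeasurable" "measure lebesgue U < d"
    proof -
      have NN: "N \<in> null_sets lebesgue" using N by (simp add: negligible_iff_null_sets)
      obtain U where U: "open U" "N \<subseteq> U" "U - N \<in> lmeasurable" "emeasure lebesgue (U - N) < ennreal d"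
        using sets_lebesgue_outer_open[of N d] NN d by blast
      have "U = (U - N) \<union> N" using U by blast
      then have "U \<in> lmeasurable" "measure lebesgue U = measure lebesgue (U - N)"
        using U NN by (metis fmeasurable.Un negligible_iff_null_sets negligible_imp_measurable,
                       simp add: measure_Diff_null_set fmeasurableD U(1) lebesgue_openin)
      moreover have "measure lebesgue (U - N) < d"
        using U(3,4) d by (simp add: emeasure_eq_measure2 ennreal_less_iff)
      ultimately show ?thesis using that U by auto
    qed
    have "\<forall>t. \<exists>r>0. (t \<in> N \<longrightarrow> ball t r \<subseteq> U) \<and>
         (t \<notin> N \<longrightarrow> (\<forall>\<alpha> \<beta>. \<alpha> \<le> t \<longrightarrow> t \<le> \<beta> \<longrightarrow> \<alpha> \<in> ball t r \<longrightarrow> \<beta> \<in> ball t r \<longrightarrow>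
              \<bar>F \<beta> - F \<alpha> - (\<beta> - \<alpha>) * f t\<bar> \<le> \<eta> * (\<beta> - \<alpha>)))"
    proof
      fix t show "\<exists>r>0. (t \<in> N \<longrightarrow> ball t r \<subseteq> U) \<and>
         (t \<notin> N \<longrightarrow> (\<forall>\<alpha> \<beta>. \<alpha> \<le> t \<longrightarrow> t \<le> \<beta> \<longrightarrow> \<alpha> \<in> ball t r \<longrightarrow> \<beta> \<in> ball t r \<longrightarrow>
              \<bar>F \<beta> - F \<alpha> - (\<beta> - \<alpha>) * f t\<bar> \<le> \<eta> * (\<beta> - \<alpha>)))"
      proof (cases "t \<in> N")
        case True
        then show ?thesis using U openE[of U t] by blast
      next
        case False
        then show ?thesis using straddle_estimate[OF off[OF False] \<eta>] by metis
      qed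
    qed
    then obtain r where r: "\<And>t. r t > 0" "\<And>t. t \<in> N \<Longrightarrow> ball t (r t) \<subseteq> U"
      "\<And>t \<alpha> \<beta>. \<lbrakk>t \<notin> N; \<alpha> \<le> t; t \<le> \<beta>; \<alpha> \<in> ball t (r t); \<beta> \<in> ball t (r t)\<rbrakk>
          \<Longrightarrow> \<bar>F \<beta> - F \<alpha> - (\<beta> - \<alpha>) * f t\<bar> \<le> \<eta> * (\<beta> - \<alpha>)"
      by metis
    show "\<exists>\<gamma>. gauge \<gamma> \<and> (\<forall>p. p tagged_division_of {x..y} \<and> \<gamma> fine p \<longrightarrow>
             norm ((\<Sum>(t, K)\<in>p. measure lborel K *\<^sub>R h t) - (F y - F x)) < e)"
    proof (intro exI conjI allI impI)
      show "gauge (\<lambda>t. ball t (r t))" using r(1) by (rule gauge_ball_dependent[rule_format])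
    next
      fix p assume "p tagged_division_of {x..y} \<and> (\<lambda>t. ball t (r t)) fine p"
      then have p: "p tagged_division_of {x..y}" and fine: "(\<lambda>t. ball t (r t)) fine p" by auto
      have pp: "p tagged_partial_division_of {x..y}" using p by (simp add: tagged_division_of_def)
      have fin: "finite p" using p by blast
      define q where "q = {(t, K) \<in> p. t \<in> N}"
      have qp: "q \<subseteq> p" by (auto simp: q_def)
      have cell: "\<exists>\<alpha> \<beta>. K = {\<alpha>..\<beta>} \<and> \<alpha> \<le> t \<and> t \<le> \<beta> \<and> K \<subseteq> ball t (r t)" if "(t, K) \<in> p" for t K
        using tagged_partial_division_ofD(2,4)[OF pp that] fineD[OF fine that] by (auto simp: box_real)
      have sums: "y - x = (\<Sum>(t, K)\<in>p. Sup K - Inf K)" "F y - F x = (\<Sum>(t, K)\<in>p. F (Sup K) - F (Inf K))"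
        using additive_tagged_division_1[OF xy p, of "\<lambda>x. x"] additive_tagged_division_1[OF xy p, of F]
        by auto
      define E where "E = (\<lambda>(t, K). measure lborel K * h t - (F (Sup K) - F (Inf K)))"
      have bad: "\<bar>\<Sum>k\<in>q. E k\<bar> < e / 2"
      proof -
        have qq: "q tagged_partial_division_of {x..y}"
          using tagged_partial_division_subset[OF pp qp] .
        have "(\<Sum>(t, K)\<in>q. measure lborel K) \<le> measure lebesgue U"
          by (rule tagged_content_le_measure[OF qq U(3)]) (use cell r(2) in \<open>fastforce simp: q_def\<close>)
        then have lt: "(\<Sum>(t, K)\<in>q. \<bar>F (Sup K) - F (Inf K)\<bar>) < e / 2"
          using dp[OF qq] U(4) by simp
        have "\<bar>\<Sum>k\<in>q. E k\<bar> \<le> (\<Sum>k\<in>q. \<bar>E k\<bar>)" by (rule sum_abs)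
        also have "\<dots> = (\<Sum>(t, K)\<in>q. \<bar>F (Sup K) - F (Inf K)\<bar>)"
          by (rule sum.cong) (auto simp: q_def E_def h_def)
        finally show ?thesis using lt by simp
      qed
      have good: "\<bar>\<Sum>k\<in>p - q. E k\<bar> \<le> \<eta> * (y - x)"
      proof -
        have "\<bar>\<Sum>k\<in>p - q. E k\<bar> \<le> (\<Sum>k\<in>p - q. \<bar>E k\<bar>)" by (rule sum_abs)
        also have "\<dots> \<le> (\<Sum>(t, K)\<in>p - q. \<eta> * (Sup K - Inf K))"
        proof (rule sum_mono, clarify)
          fix t K assume tK: "(t, K) \<in> p" "(t, K) \<notin> q"
          then have "t \<notin> N" by (auto simp: q_def)
          moreover obtain \<alpha> \<beta> where K: "K = {\<alpha>..\<beta>}" "\<alpha> \<le> t" "t \<le> \<beta>" "K \<subseteq> ball t (r t)"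
            using cell[OF tK(1)] by blast
          moreover have "\<alpha> \<in> ball t (r t)" "\<beta> \<in> ball t (r t)"
            using K by (auto intro: subsetD[OF K(4)] simp del: mem_ball)
          ultimately have "\<bar>F \<beta> - F \<alpha> - (\<beta> - \<alpha>) * f t\<bar> \<le> \<eta> * (\<beta> - \<alpha>)" using r(3) by blast
          then show "\<bar>E (t, K)\<bar> \<le> \<eta> * (Sup K - Inf K)"
            using K \<open>t \<notin> N\<close> by (simp add: E_def h_def abs_minus_commute)
        qed
        also have "\<dots> \<le> (\<Sum>(t, K)\<in>p. \<eta> * (Sup K - Inf K))"
          by (rule sum_mono2[OF fin]) (use \<eta> cell in \<open>fastforce simp: q_def\<close>)+
        also have "\<dots> = \<eta> * (y - x)" by (simp add: sums(1) sum_distrib_left split_def)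
        finally show ?thesis .
      qed
      have "(\<Sum>(t, K)\<in>p. measure lborel K *\<^sub>R h t) - (F y - F x) = (\<Sum>k\<in>p. E k)"
        by (simp add: sums(2) E_def split_def sum_subtractf)
      also have "\<dots> = (\<Sum>k\<in>p - q. E k) + (\<Sum>k\<in>q. E k)"
        by (rule sum.subset_diff[OF qp fin])
      finally show "norm ((\<Sum>(t, K)\<in>p. measure lborel K *\<^sub>R h t) - (F y - F x)) < e"
        using bad good \<eta>_small by simp
    qed
  qed
  then show ?thesis
    by (rule has_integral_spike[OF N, rotated]) (simp add: h_def)
qed

lemma has_integral_le_AE:
  fixes f h :: "real \<Rightarrow> real"
  assumes f: "(f has_integral i) {x..y}" and h: "(h has_integral j) {x..y}"
    and le: "AE t in lebesgue. t \<in> {x..y} \<longrightarrow> f t \<le> h t"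
  shows "i \<le> j"
proof -
  obtain N where N: "negligible N" "\<And>t. t \<notin> N \<Longrightarrow> t \<in> {x..y} \<Longrightarrow> f t \<le> h t"
    using le by (auto simp: eventually_ae_filter_negligible)
  have "((\<lambda>t. if t \<in> N then h t else f t) has_integral i) {x..y}"
    by (rule has_integral_spike[OF N(1) _ f]) simp
  then show ?thesis by (rule has_integral_le[OF _ h]) (use N(2) in auto)
qed

section \<open>Differentiation of weighted primitives\<close>

text \<open>
  Lebesgue differentiation for intervals ending at \<open>t\<close> as well as for those starting there. The left-hand
  means are right-hand means of the reflected function.
\<close>

lemma AE_integral_mean_two_sided:
  fixes f :: "real \<Rightarrow> real"
  assumes f: "\<And>x y. f integrable_on {x..y}"
  shows "AE t in lebesgue. \<forall>e>0. \<exists>d>0. \<forall>h. 0 < h \<and> h < d \<longrightarrow>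
    \<bar>integral {t..t + h} f - h * f t\<bar> \<le> e * h \<and> \<bar>integral {t - h..t} f - h * f t\<bar> \<le> e * h"
proof -
  have right: "\<exists>N. negligible N \<and> (\<forall>t e. t \<notin> N \<longrightarrow> e > 0 \<longrightarrow> (\<exists>d>0. \<forall>h. 0 < h \<and> h < d \<longrightarrow>
      \<bar>integral {t..t + h} f - h * f t\<bar> \<le> e * h))"
    if f: "\<And>x y. f integrable_on {x..y}" for f :: "real \<Rightarrow> real"
  proof -
    obtain N where N: "negligible N" and N_lim: "\<And>x e. \<lbrakk>x \<notin> N; 0 < e\<rbrakk> \<Longrightarrow>
        \<exists>d>0. \<forall>h. 0 < h \<and> h < d \<longrightarrow> norm (integral (cbox x (x + h *\<^sub>R One)) f /\<^sub>R h ^ DIM(real) - f x) < e"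
      using integrable_ccontinuous_explicit[of f] f by (metis box_real(2))
    have "\<exists>d>0. \<forall>h. 0 < h \<and> h < d \<longrightarrow> \<bar>integral {t..t + h} f - h * f t\<bar> \<le> e * h"
      if t: "t \<notin> N" "e > 0" for t e
    proof -
      obtain d where d: "d > 0" "\<And>h. \<lbrakk>0 < h; h < d\<rbrakk> \<Longrightarrow> \<bar>integral {t..t + h} f / h - f t\<bar> < e"
        using N_lim[OF t] by (auto simp: divide_inverse mult.commute)
      have "\<bar>integral {t..t + h} f - h * f t\<bar> \<le> e * h" if h: "0 < h" "h < d" for h
      proof -
        have "integral {t..t + h} f - h * f t = h * (integral {t..t + h} f / h - f t)"
          using h by (simp add: field_simps)
        then have "\<bar>integral {t..t + h} f - h * f t\<bar> = h * \<bar>integral {t..t + h} f / h - f t\<bar>"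
          using h by (simp add: abs_mult)
        then show ?thesis using d(2)[OF h] h by (simp add: mult.commute)
      qed
      then show ?thesis using d(1) by blast
    qed
    then show ?thesis using N by blast
  qed
  obtain N1 where N1: "negligible N1" "\<And>t e. \<lbrakk>t \<notin> N1; e > 0\<rbrakk> \<Longrightarrow> \<exists>d>0. \<forall>h. 0 < h \<and> h < d \<longrightarrow>
      \<bar>integral {t..t + h} f - h * f t\<bar> \<le> e * h"
    using right[of f] f by blast
  have "(\<lambda>s. f (- s)) integrable_on {x..y}" for x y
    using Henstock_Kurzweil_Integration.integrable_reflect_real
        [where f = f and a = "- y" and b = "- x", THEN iffD2, OF f] by simp
  then obtain N2 where N2: "negligible N2" "\<And>t e. \<lbrakk>t \<notin> N2; e > 0\<rbrakk> \<Longrightarrow> \<exists>d>0. \<forall>h. 0 < h \<and> h < d \<longrightarrow>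
      \<bar>integral {t..t + h} (\<lambda>s. f (- s)) - h * f (- t)\<bar> \<le> e * h"
    using right[of "\<lambda>s. f (- s)"] by blast
  have neg: "negligible (N1 \<union> uminus ` N2)"
    using N1(1) N2(1)
    by (intro negligible_Un negligible_differentiable_image_negligible)
       (auto intro!: derivative_intros simp: differentiable_on_def)
  have "\<exists>d>0. \<forall>h. 0 < h \<and> h < d \<longrightarrow>
    \<bar>integral {t..t + h} f - h * f t\<bar> \<le> e * h \<and> \<bar>integral {t - h..t} f - h * f t\<bar> \<le> e * h"
    if t: "t \<notin> N1 \<union> uminus ` N2" and e: "e > 0" for t e
  proof -
    obtain d1 where d1: "d1 > 0" "\<And>h. \<lbrakk>0 < h; h < d1\<rbrakk> \<Longrightarrow> \<bar>integral {t..t + h} f - h * f t\<bar> \<le> e * h"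
      using N1(2)[of t e] t e by auto
    have "- t \<notin> N2" using t by force
    then obtain d2 where d2: "d2 > 0"
        "\<And>h. \<lbrakk>0 < h; h < d2\<rbrakk> \<Longrightarrow> \<bar>integral {- t..- t + h} (\<lambda>s. f (- s)) - h * f t\<bar> \<le> e * h"
      using N2(2)[of "- t" e] e by auto
    have "integral {- t..- t + h} (\<lambda>s. f (- s)) = integral {t - h..t} f" for h
    proof -
      have "- t + h = - (t - h)" by simp
      then show ?thesis by (simp only: Henstock_Kurzweil_Integration.integral_reflect_real)
    qed
    then show ?thesis using d1 d2 by (intro exI[of _ "min d1 d2"]) auto
  qed
  then show ?thesis
    unfolding eventually_ae_filter_negligible by (intro exI[of _ "N1 \<union> uminus ` N2"] conjI neg) blast
qed

text \<open>
  The exceptional null set does not depend on the weight \<open>w\<close>. It suffices that the means of \<open>a\<close> and of \<open>\<bar>a\<bar>\<close>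
  converge at \<open>t\<close>: replacing the continuous \<open>w\<close> by the constant \<open>w t\<close> costs its oscillation near \<open>t\<close> times the
  mean of \<open>\<bar>a\<bar>\<close>, which stays bounded.
\<close>

lemma AE_derivative_of_weighted_primitive:
  fixes a :: "real \<Rightarrow> real"
  assumes a: "locally_integrable a"
  shows "AE t in lebesgue. \<forall>w F. continuous_on UNIV w \<longrightarrow>
      (\<forall>x y. x \<le> y \<longrightarrow> ((\<lambda>s. a s * w s) has_integral F y - F x) {x..y}) \<longrightarrow>
      (F has_real_derivative a t * w t) (at t)"
proof -
  have int: "a integrable_on {x..y}" "(\<lambda>s. \<bar>a s\<bar>) integrable_on {x..y}" for x y
    using a unfolding locally_integrable_def absolutely_integrable_on_def by auto
  show ?thesis
    using AE_integral_mean_two_sided[OF int(1)] AE_integral_mean_two_sided[OF int(2)]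
  proof eventually_elim
    case (elim t)
    show ?case
    proof (intro allI impI)
      fix w F :: "real \<Rightarrow> real"
      assume w: "continuous_on UNIV w"
        and F: "\<forall>x y. x \<le> y \<longrightarrow> ((\<lambda>s. a s * w s) has_integral F y - F x) {x..y}"
      have "\<exists>d>0. \<forall>s. \<bar>s - t\<bar> < d \<longrightarrow> \<bar>F s - F t - a t * w t * (s - t)\<bar> \<le> e * \<bar>s - t\<bar>"
        if e: "e > 0" for e
      proof -
        \<comment> \<open>\<open>\<eta>\<close> bounds the oscillation of \<open>w\<close>, \<open>\<epsilon>\<close> the error in the mean of \<open>a\<close>; each costs \<open>e / 2\<close>\<close>
        define \<eta> where "\<eta> = e / (2 * (\<bar>a t\<bar> + 1))"
        define \<epsilon> where "\<epsilon> = e / (2 * (\<bar>w t\<bar> + 1))"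
        have pos: "\<eta> > 0" "\<epsilon> > 0" using e by (auto simp: \<eta>_def \<epsilon>_def add_nonneg_pos)
        have \<eta>_eq: "\<eta> * (\<bar>a t\<bar> + 1) = e / 2" unfolding \<eta>_def by (simp add: field_simps)
        have \<epsilon>_le: "\<bar>w t\<bar> * \<epsilon> \<le> e / 2" using e unfolding \<epsilon>_def by (simp add: field_simps)
        obtain d0 where d0: "d0 > 0" "\<And>s. \<bar>s - t\<bar> < d0 \<Longrightarrow> \<bar>w s - w t\<bar> < \<eta>"
        proof -
          have "isCont w t" using w by (simp add: continuous_on_eq_continuous_at)
          then show ?thesis using that pos(1) unfolding continuous_at_eps_delta dist_real_def by blast
        qed
        from elim(1)[rule_format, OF pos(2)] obtain d1 where d1: "d1 > 0"
            "\<forall>h. 0 < h \<and> h < d1 \<longrightarrow> \<bar>integral {t..t + h} a - h * a t\<bar> \<le> \<epsilon> * h \<and>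
              \<bar>integral {t - h..t} a - h * a t\<bar> \<le> \<epsilon> * h"
          by (elim exE conjE)
        from elim(2)[rule_format, OF zero_less_one] obtain d2 where d2: "d2 > 0"
            "\<forall>h. 0 < h \<and> h < d2 \<longrightarrow> \<bar>integral {t..t + h} (\<lambda>s. \<bar>a s\<bar>) - h * \<bar>a t\<bar>\<bar> \<le> 1 * h \<and>
              \<bar>integral {t - h..t} (\<lambda>s. \<bar>a s\<bar>) - h * \<bar>a t\<bar>\<bar> \<le> 1 * h"
          by (elim exE conjE)
        \<comment> \<open>used with \<open>t\<close> as the left or as the right end point\<close>
        have est: "\<bar>F y - F x - a t * w t * (y - x)\<bar> \<le> e * (y - x)"
          if xy: "x \<le> y" and near: "\<And>s. s \<in> {x..y} \<Longrightarrow> \<bar>s - t\<bar> < d0"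
            and A: "\<bar>integral {x..y} a - (y - x) * a t\<bar> \<le> \<epsilon> * (y - x)"
            and B: "\<bar>integral {x..y} (\<lambda>s. \<bar>a s\<bar>) - (y - x) * \<bar>a t\<bar>\<bar> \<le> 1 * (y - x)" for x y
        proof -
          have I: "((\<lambda>s. a s * w s - a s * w t) has_integral (F y - F x - integral {x..y} a * w t)) {x..y}"
            using F xy int(1) by (intro has_integral_diff has_integral_mult_left) auto
          have bound: "\<bar>a s * w s - a s * w t\<bar> \<le> \<bar>a s\<bar> * \<eta>" if "s \<in> {x..y}" for s
          proof -
            have "\<bar>a s * w s - a s * w t\<bar> = \<bar>a s\<bar> * \<bar>w s - w t\<bar>"
              by (simp add: abs_mult right_diff_distrib[symmetric])
            also have "\<dots> \<le> \<bar>a s\<bar> * \<eta>"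
              using d0(2)[OF near[OF that]] by (intro mult_left_mono) auto
            finally show ?thesis .
          qed
          have "\<bar>F y - F x - integral {x..y} a * w t\<bar> \<le> integral {x..y} (\<lambda>s. \<bar>a s\<bar> * \<eta>)"

            using integral_norm_bound_integral[OF has_integral_integrable[OF I], of "\<lambda>s. \<bar>a s\<bar> * \<eta>"]
              integral_unique[OF I] int(2) d0(2) near
              bound by (simp add: integrable_on_mult_left)
          also have "\<dots> = integral {x..y} (\<lambda>s. \<bar>a s\<bar>) * \<eta>" by simp
          also have "\<dots> \<le> ((y - x) * (\<bar>a t\<bar> + 1)) * \<eta>"
            using B pos by (intro mult_right_mono) (auto simp: algebra_simps abs_le_iff)
          also have "\<dots> = e / 2 * (y - x)" using \<eta>_eq by (simp add: mult.commute mult.left_commute)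
          finally have 1: "\<bar>F y - F x - integral {x..y} a * w t\<bar> \<le> e / 2 * (y - x)" .
          have "\<bar>(integral {x..y} a - (y - x) * a t) * w t\<bar> \<le> (\<epsilon> * (y - x)) * \<bar>w t\<bar>"
            unfolding abs_mult using A by (intro mult_right_mono) auto
          also have "\<dots> \<le> e / 2 * (y - x)"
            using mult_right_mono[OF \<epsilon>_le, of "y - x"] xy by (simp add: algebra_simps)
          finally have 2: "\<bar>(integral {x..y} a - (y - x) * a t) * w t\<bar> \<le> e / 2 * (y - x)" .
          have "F y - F x - a t * w t * (y - x)
              = (F y - F x - integral {x..y} a * w t) + (integral {x..y} a - (y - x) * a t) * w t"
            by (simp add: algebra_simps)
          then have "\<bar>F y - F x - a t * w t * (y - x)\<bar> \<le> \<bar>F y - F x - integral {x..y} a * w t\<bar>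
              + \<bar>(integral {x..y} a - (y - x) * a t) * w t\<bar>"
            by (simp only: abs_triangle_ineq)
          then show ?thesis using 1 2 by (simp add: field_simps)
        qed
        have "\<bar>F s - F t - a t * w t * (s - t)\<bar> \<le> e * \<bar>s - t\<bar>"
          if s: "\<bar>s - t\<bar> < min d0 (min d1 d2)" for s
        proof -
          consider "s = t" | "s > t" | "s < t" by linarith
          then show ?thesis
          proof cases
            case 2
            then show ?thesis
              using est[of t s] d1(2)[rule_format, of "s - t"] d2(2)[rule_format, of "s - t"] s by auto
          next
            case 3
            have "\<bar>F t - F s - a t * w t * (t - s)\<bar> \<le> e * (t - s)"
              using 3 est[of s t] d1(2)[rule_format, of "t - s"] d2(2)[rule_format, of "t - s"] s by auto
            moreover have "F s - F t - a t * w t * (s - t) = - (F t - F s - a t * w t * (t - s))"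
              by (simp add: algebra_simps)
            ultimately show ?thesis using 3 by simp
          qed simp
        qed
        then show ?thesis using d0(1) d1(1) d2(1) by (intro exI[of _ "min d0 (min d1 d2)"]) auto
      qed
      then show "(F has_real_derivative a t * w t) (at t)"
        unfolding has_field_derivative_def has_derivative_at_alt
        by (simp add: bounded_linear_mult_right)
    qed
  qed
qed

section \<open>The Minkowski curvature operator\<close>

definition phi_inv :: "real \<Rightarrow> real" where
  "phi_inv y = y / sqrt (1 + y\<^sup>2)"

lemma phi_inv_phi:
  assumes "\<bar>x\<bar> < 1"
  shows "phi_inv (phi x) = x"
proof -
  have pos: "0 < 1 - x\<^sup>2" using assms by (simp add: abs_square_less_1)
  have "1 + (phi x)\<^sup>2 = 1 / (1 - x\<^sup>2)"
    using pos by (simp add: phi_def power_divide field_simps)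
  then have "sqrt (1 + (phi x)\<^sup>2) = 1 / sqrt (1 - x\<^sup>2)" by (simp add: real_sqrt_divide)
  then show ?thesis using pos by (simp add: phi_inv_def phi_def)
qed

text \<open>
  The derivative is \<open>(1 + y\<^sup>2)\<close> to the power \<open>- 3/2\<close>.
\<close>

lemma phi_inv_has_derivative:
  obtains D where "(phi_inv has_real_derivative D) (at y)" "0 \<le> D" "D \<le> 1"
proof -
  have pos: "0 < 1 + y\<^sup>2" by (simp add: add_pos_nonneg)
  define q where "q = sqrt (1 + y\<^sup>2)"
  have q: "q \<ge> 1" "q * q = 1 + y\<^sup>2" using pos by (simp_all add: q_def)
  have "(phi_inv has_real_derivative 1 / (q * q * q)) (at y)"
  proof -
    have "((\<lambda>y. y / sqrt (1 + y\<^sup>2)) has_real_derivative (1 * q - y * (inverse q / 2 * (2 * y))) / (q * q)) (at y)"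
      unfolding q_def using pos
      by (auto intro!: derivative_eq_intros simp: power2_eq_square)
    moreover have "(1 * q - y * (inverse q / 2 * (2 * y))) / (q * q) = 1 / (q * q * q)"
    proof -
      have "1 * q - y * (inverse q / 2 * (2 * y)) = (q * q - y\<^sup>2) / q"
        using q by (simp add: field_simps power2_eq_square)
      also have "\<dots> = 1 / q" using q by simp
      finally show ?thesis using q by (simp add: field_simps)
    qed
    ultimately show ?thesis by (simp add: phi_inv_def[abs_def])
  qed
  moreover have "1 \<le> q * q * q"
    using one_le_power[OF q(1), of 3] by (simp add: power3_eq_cube)
  then have "0 \<le> 1 / (q * q * q) \<and> 1 / (q * q * q) \<le> 1" by simp
  ultimately show ?thesis using that by metis
qed

lemma phi_inv_mono:
  assumes "y \<le> z"
  shows "phi_inv y \<le> phi_inv z"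
  using assms
proof (rule DERIV_nonneg_imp_nondecreasing)
  fix x
  obtain D where "(phi_inv has_real_derivative D) (at x)" "0 \<le> D"
    by (rule phi_inv_has_derivative)
  then show "\<exists>D. (phi_inv has_real_derivative D) (at x) \<and> 0 \<le> D" by blast
qed

lemma abs_phi_inv_le: "\<bar>phi_inv y\<bar> \<le> \<bar>y\<bar>"
proof -
  have "1 \<le> sqrt (1 + y\<^sup>2)" by simp
  then have "\<bar>y\<bar> / sqrt (1 + y\<^sup>2) \<le> \<bar>y\<bar> / 1"
    by (intro divide_left_mono) (auto simp: add_pos_nonneg)
  then show ?thesis by (simp add: phi_inv_def)
qed

text \<open>
  A linear bound for slopes up to \<open>1/2\<close>. It is stated through an upper bound \<open>b\<close> of \<open>x\<close> so that negative
  slopes, for which nothing but the sign is known, are covered too.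
\<close>

lemma phi_le_twice:
  assumes "x \<le> b" "0 \<le> b" "b \<le> 1/2" "-1 < x"
  shows "phi x \<le> 2 * b"
proof (cases "x \<le> 0")
  case True
  then have "phi x \<le> 0"
    using assms abs_square_less_1[of x] by (simp add: phi_def divide_nonpos_nonneg)
  then show ?thesis using assms by simp
next
  case False
  then have "x * x \<le> 1/2 * (1/2)" using assms by (intro mult_mono) auto
  then have root: "1/2 \<le> sqrt (1 - x\<^sup>2)" by (intro real_le_rsqrt) (simp add: power2_eq_square)
  then have "0 < sqrt (1 - x\<^sup>2)" by linarith
  then have "x / sqrt (1 - x\<^sup>2) \<le> x / (1/2)"
    using False root by (intro divide_left_mono mult_pos_pos) auto
  then show ?thesis using assms by (simp add: phi_def)
qed

lemma phi_minus: "phi (- x) = - phi x"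
  by (simp add: phi_def)

section \<open>Periodic functions\<close>

lemma periodic_with_int:
  assumes "periodic_with T f"
  shows "f (t + of_int k * T) = f t"
proof (induction k rule: int_induct[of _ 0])
  case base
  show ?case by simp
next
  case (step1 i)
  then show ?case using assms unfolding periodic_with_def
    by (metis add.assoc distrib_right mult_1 of_int_1 of_int_add)
next
  case (step2 i)
  have "f (t + of_int (i - 1) * T) = f ((t + of_int (i - 1) * T) + T)"
    using assms by (simp add: periodic_with_def)
  also have "(t + of_int (i - 1) * T) + T = t + of_int i * T" by (simp add: algebra_simps)
  finally show ?case using step2 by simp
qed

lemma periodic_representative:
  fixes T t :: real
  assumes "T > 0"
  obtains k :: int where "t + of_int k * T \<in> {0..T}"
proof (rule that)
  have "of_int \<lfloor>t / T\<rfloor> * T \<le> t" "t \<le> (of_int \<lfloor>t / T\<rfloor> + 1) * T"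
    using assms floor_divide_lower[of T t] floor_divide_upper[of T t] by auto
  then show "t + of_int (- \<lfloor>t / T\<rfloor>) * T \<in> {0..T}" by (auto simp: algebra_simps)
qed

lemma periodic_attains_max:
  fixes f :: "real \<Rightarrow> real"
  assumes "T > 0" and per: "periodic_with T f" and cont: "continuous_on UNIV f"
  shows "\<exists>s\<in>{0..T}. \<forall>t. f t \<le> f s"
proof -
  have "\<exists>s\<in>{0..T}. \<forall>t\<in>{0..T}. f t \<le> f s"
    using \<open>T > 0\<close> by (intro continuous_attains_sup continuous_on_subset[OF cont]) auto
  then obtain s where s: "s \<in> {0..T}" "\<forall>t\<in>{0..T}. f t \<le> f s" by (elim bexE)
  have "f t \<le> f s" for t
  proof -
    obtain k :: int where "t + of_int k * T \<in> {0..T}" using periodic_representative[OF \<open>T > 0\<close>] .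
    then show ?thesis using s(2)[rule_format, of "t + of_int k * T"] periodic_with_int[OF per, of t k] by simp
  qed
  then show ?thesis using s(1) by blast
qed

lemma periodic_with_deriv:
  assumes der: "\<And>t. (u has_real_derivative deriv u t) (at t)" and per: "periodic_with T u"
  shows "periodic_with T (deriv u)"
proof -
  have "deriv u (t + T) = deriv u t" for t
  proof -
    have "((\<lambda>x. u (x + T)) has_real_derivative deriv u (t + T)) (at t)"
      using der[of "t + T"] by (simp add: DERIV_shift)
    moreover have "(\<lambda>x. u (x + T)) = u" using per by (auto simp: periodic_with_def)
    ultimately show ?thesis using DERIV_imp_deriv by metis
  qed
  then show ?thesis by (simp add: periodic_with_def)
qed

text \<open>
  The sum of a compact set and a closed one, namely the lattice of multiples of \<open>T\<close>.
\<close>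

lemma closed_saturation: "closed (saturation T {\<alpha>..\<beta>})"
proof -
  have "closed ((\<lambda>x. T *\<^sub>R x) ` (range of_int :: real set))"
    by (rule closed_scaling) (rule closed_of_int_image)
  then have "closed (\<Union>x\<in>{\<alpha>..\<beta>}. \<Union>y\<in>(\<lambda>x. T *\<^sub>R x) ` (range of_int :: real set). {x + y})"
    by (intro compact_closed_sums) auto
  moreover have "(\<Union>x\<in>{\<alpha>..\<beta>}. \<Union>y\<in>(\<lambda>x. T *\<^sub>R x) ` (range of_int :: real set). {x + y}) = saturation T {\<alpha>..\<beta>}"
    by (auto simp: saturation_def mult.commute)
  ultimately show ?thesis by simp
qed

section \<open>Concave arcs and power growth\<close>

text \<open>
  The graph of a concave function lies above the chord from \<open>\<sigma>\<close> to \<open>s\<close>, and the value at \<open>\<sigma>\<close> is nonnegative.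
\<close>

lemma concave_chord_left:
  fixes u u' :: "real \<Rightarrow> real"
  assumes der: "\<And>x. (u has_real_derivative u' x) (at x)"
    and anti: "\<And>x y. \<lbrakk>\<sigma> \<le> x; x \<le> y; y \<le> \<tau>\<rbrakk> \<Longrightarrow> u' y \<le> u' x"
    and u0: "u \<sigma> \<ge> 0" "u t \<ge> 0" and ord: "\<sigma> \<le> t" "t \<le> s" "s \<le> \<tau>"
  shows "u s * (t - \<sigma>) \<le> u t * (s - \<sigma>)"
proof (cases "\<sigma> = t \<or> t = s")
  case True
  then show ?thesis using u0 ord by auto
next
  case False
  then have lt: "\<sigma> < t" "t < s" using ord by auto
  obtain \<xi> where \<xi>: "\<sigma> < \<xi>" "\<xi> < t" "u t - u \<sigma> = (t - \<sigma>) * u' \<xi>"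
    using MVT2[OF lt(1), of u u'] der by blast
  obtain \<zeta> where \<zeta>: "t < \<zeta>" "\<zeta> < s" "u s - u t = (s - t) * u' \<zeta>"
    using MVT2[OF lt(2), of u u'] der by blast
  have "(s - t) * (t - \<sigma>) * u' \<zeta> \<le> (s - t) * (t - \<sigma>) * u' \<xi>"
    using anti[of \<xi> \<zeta>] \<xi> \<zeta> lt ord by (intro mult_left_mono) auto
  then have "(u s - u t) * (t - \<sigma>) \<le> (u t - u \<sigma>) * (s - t)"
    by (simp add: \<xi>(3) \<zeta>(3) mult.commute mult.left_commute)
  moreover have "(u t - u \<sigma>) * (s - t) \<le> u t * (s - t)"
    using u0 lt by (intro mult_right_mono) auto
  ultimately show ?thesis by (simp add: algebra_simps)
qed

lemma concave_chord_right:
  fixes u u' :: "real \<Rightarrow> real"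
  assumes der: "\<And>x. (u has_real_derivative u' x) (at x)"
    and anti: "\<And>x y. \<lbrakk>\<sigma> \<le> x; x \<le> y; y \<le> \<tau>\<rbrakk> \<Longrightarrow> u' y \<le> u' x"
    and u0: "u \<tau> \<ge> 0" "u t \<ge> 0" and ord: "\<sigma> \<le> s" "s \<le> t" "t \<le> \<tau>"
  shows "u s * (\<tau> - t) \<le> u t * (\<tau> - s)"
proof -
  have "((\<lambda>x. u (- x)) has_real_derivative - u' (- x)) (at x)" for x
    using DERIV_mirror[of u "u' (- x)" x, THEN iffD1, OF der] by simp
  from concave_chord_left[OF this, where \<sigma> = "- \<tau>" and \<tau> = "- \<sigma>" and t = "- t" and s = "- s"]
  show ?thesis using anti u0 ord by (simp add: algebra_simps)
qed

text \<open>
  The lower bound compares with the triangle of height \<open>u s\<close> over \<open>{\<sigma>..\<tau>}\<close>. For the slopes, the increment of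
  \<open>u\<close> over the first piece of length \<open>2 * \<rho>\<close> is at most \<open>u s\<close>, and the slope at the right end of that piece is its
  smallest one; the last piece is symmetric.
\<close>

lemma concave_hump_estimates:
  fixes u u' :: "real \<Rightarrow> real"
  assumes der: "\<And>x. (u has_real_derivative u' x) (at x)"
    and anti: "\<And>x y. \<lbrakk>\<sigma> \<le> x; x \<le> y; y \<le> \<tau>\<rbrakk> \<Longrightarrow> u' y \<le> u' x"
    and pos: "\<And>x. u x \<ge> 0" and \<rho>: "0 < \<rho>" "4 * \<rho> < \<tau> - \<sigma>"
    and s: "s \<in> {\<sigma>..\<tau>}" and max: "\<And>x. x \<in> {\<sigma>..\<tau>} \<Longrightarrow> u x \<le> u s"
  shows "\<And>t. t \<in> {\<sigma> + 2 * \<rho>..\<tau> - 2 * \<rho>} \<Longrightarrow> 2 * \<rho> / (\<tau> - \<sigma>) * u s \<le> u t"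
    and "u' (\<sigma> + 2 * \<rho>) \<le> u s / (2 * \<rho>)" and "- u' (\<tau> - 2 * \<rho>) \<le> u s / (2 * \<rho>)"
proof -
  fix t assume t: "t \<in> {\<sigma> + 2 * \<rho>..\<tau> - 2 * \<rho>}"
  have "2 * \<rho> * u s \<le> (\<tau> - \<sigma>) * u t"
  proof (cases "t \<le> s")
    case True
    have "2 * \<rho> * u s \<le> (t - \<sigma>) * u s" using t pos by (intro mult_right_mono) auto
    also have "\<dots> \<le> (s - \<sigma>) * u t"
      using concave_chord_left[OF der anti, of \<sigma> \<tau> t s] pos True t s \<rho> by (auto simp: mult.commute)
    also have "\<dots> \<le> (\<tau> - \<sigma>) * u t" using s pos by (intro mult_right_mono) auto
    finally show ?thesis .
  next
    case False
    have "2 * \<rho> * u s \<le> (\<tau> - t) * u s" using t pos by (intro mult_right_mono) auto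
    also have "\<dots> \<le> (\<tau> - s) * u t"
      using concave_chord_right[OF der anti, of \<sigma> \<tau> t s] pos False t s \<rho> by (auto simp: mult.commute)
    also have "\<dots> \<le> (\<tau> - \<sigma>) * u t" using s pos by (intro mult_right_mono) auto
    finally show ?thesis .
  qed
  then show "2 * \<rho> / (\<tau> - \<sigma>) * u s \<le> u t" using \<rho> by (simp add: field_simps)
next
  obtain \<xi> where \<xi>: "\<sigma> < \<xi>" "\<xi> < \<sigma> + 2 * \<rho>" "u (\<sigma> + 2 * \<rho>) - u \<sigma> = (\<sigma> + 2 * \<rho> - \<sigma>) * u' \<xi>"
    using MVT2[of \<sigma> "\<sigma> + 2 * \<rho>" u u'] der \<rho> by auto
  have "2 * \<rho> * u' (\<sigma> + 2 * \<rho>) \<le> 2 * \<rho> * u' \<xi>"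
    using anti[of \<xi> "\<sigma> + 2 * \<rho>"] \<xi> \<rho> by (intro mult_left_mono) auto
  also have "\<dots> \<le> u s" using \<xi>(3) max[of "\<sigma> + 2 * \<rho>"] pos[of \<sigma>] \<rho> by simp
  finally show "u' (\<sigma> + 2 * \<rho>) \<le> u s / (2 * \<rho>)" using \<rho> by (simp add: field_simps)
next
  obtain \<xi> where \<xi>: "\<tau> - 2 * \<rho> < \<xi>" "\<xi> < \<tau>" "u \<tau> - u (\<tau> - 2 * \<rho>) = (\<tau> - (\<tau> - 2 * \<rho>)) * u' \<xi>"
    using MVT2[of "\<tau> - 2 * \<rho>" \<tau> u u'] der \<rho> by auto
  have "2 * \<rho> * u' \<xi> \<le> 2 * \<rho> * u' (\<tau> - 2 * \<rho>)"
    using anti[of "\<tau> - 2 * \<rho>" \<xi>] \<xi> \<rho> by (intro mult_left_mono) auto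
  moreover have "- u s \<le> 2 * \<rho> * u' \<xi>" using \<xi>(3) max[of "\<tau> - 2 * \<rho>"] pos[of \<tau>] \<rho> by simp
  ultimately have "- u' (\<tau> - 2 * \<rho>) * (2 * \<rho>) \<le> u s" by argo
  then show "- u' (\<tau> - 2 * \<rho>) \<le> u s / (2 * \<rho>)" using \<rho> by (simp add: pos_le_divide_eq)
qed

text \<open>
  The limit controls the quotient near \<open>0\<close>, compactness and positivity on the rest of the interval.
\<close>

lemma power_growth_two_sided:
  fixes g :: "real \<Rightarrow> real"
  assumes cont: "continuous_on {0..} g" and pos: "\<And>x. x > 0 \<Longrightarrow> g x > 0"
    and lim: "((\<lambda>x. g x / x powr p) \<longlongrightarrow> c) (at_right 0)" and c: "c > 0" and \<rho>: "\<rho> > 0"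
  shows "\<exists>k>0. \<exists>K>0. \<forall>x. 0 < x \<and> x \<le> \<rho> \<longrightarrow> k * x powr p \<le> g x \<and> g x \<le> K * x powr p"
proof -
  define q where "q x = g x / x powr p" for x
  have "eventually (\<lambda>x. c / 2 < q x \<and> q x < 2 * c) (at_right 0)"
    unfolding q_def
    by (rule eventually_conj[OF order_tendstoD(1)[OF lim] order_tendstoD(2)[OF lim]]) (use c in auto)
  then obtain \<delta> where \<delta>: "\<delta> > 0" "\<And>x. \<lbrakk>0 < x; x < \<delta>\<rbrakk> \<Longrightarrow> c / 2 < q x \<and> q x < 2 * c"
    unfolding eventually_at_right_field by auto
  define d where "d = min \<delta> \<rho>"
  have d: "0 < d" "d \<le> \<delta>" "d \<le> \<rho>" using \<delta> \<rho> by (auto simp: d_def)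
  have "continuous_on {d..\<rho>} q"
    unfolding q_def using d
    by (intro continuous_intros continuous_on_subset[OF cont]) auto
  then obtain y z where y: "y \<in> {d..\<rho>}" "\<And>x. x \<in> {d..\<rho>} \<Longrightarrow> q y \<le> q x"
    and z: "z \<in> {d..\<rho>}" "\<And>x. x \<in> {d..\<rho>} \<Longrightarrow> q x \<le> q z"
    using continuous_attains_inf[of "{d..\<rho>}" q] continuous_attains_sup[of "{d..\<rho>}" q] d
    by (metis atLeastAtMost_iff compact_Icc empty_iff order_refl)
  have qpos: "q x > 0" if "x > 0" for x using pos[OF that] that by (simp add: q_def)
  show ?thesis
  proof (intro exI conjI allI impI)
    show "min (c / 2) (q y) > 0" "max (2 * c) (q z) > 0" using c qpos y(1) d by auto
  next
    fix x assume "0 < x \<and> x \<le> \<rho>"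
    then have x: "0 < x" "x \<le> \<rho>" by auto
    have bounds: "min (c / 2) (q y) \<le> q x \<and> q x \<le> max (2 * c) (q z)"
    proof (cases "x < \<delta>")
      case True
      then show ?thesis using \<delta>(2)[OF x(1)] by auto
    next
      case False
      then have "x \<in> {d..\<rho>}" using d x by auto
      then show ?thesis using y(2)[of x] z(2)[of x] by auto
    qed
    show "min (c / 2) (q y) * x powr p \<le> g x" "g x \<le> max (2 * c) (q z) * x powr p"
      using bounds x by (simp_all add: q_def[of x] pos_le_divide_eq pos_divide_le_eq)
  qed
qed

section \<open>A priori estimates for positive periodic solutions\<close>

lemma solution_has_derivative:
  assumes "is_solution a g lam u"
  shows "(u has_real_derivative deriv u t) (at t)" and "continuous_on UNIV (deriv u)"
proof -
  obtain D where D: "\<And>x. (u has_vector_derivative D x) (at x)" "continuous_on UNIV D"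
    using assms by (auto simp: is_solution_def C1_differentiable_on_def)
  have der: "(u has_real_derivative D x) (at x)" for x
    using D(1) by (simp add: has_real_derivative_iff_has_vector_derivative)
  then have "deriv u = D" using DERIV_imp_deriv by blast
  then show "(u has_real_derivative deriv u t) (at t)" "continuous_on UNIV (deriv u)"
    using der D(2) by auto
qed

lemma solution_continuous:
  assumes "is_solution a g lam u"
  shows "continuous_on UNIV u"
  using solution_has_derivative(1)[OF assms] by (meson DERIV_isCont continuous_at_imp_continuous_on)

lemma solution_deriv_eq_phi_inv:
  assumes "is_solution a g lam u"
  shows "deriv u t = phi_inv (phi (deriv u t))"
  using assms by (simp add: is_solution_def phi_inv_phi)

text \<open>
  The equation in integrated form, the only way in which it enters the estimates.
\<close>

lemma solution_flux:
  assumes sol: "is_solution a g lam u" and xy: "x \<le> y"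
  shows "((\<lambda>t. a t * (lam * g (u t))) has_integral phi (deriv u x) - phi (deriv u y)) {x..y}"
proof -
  have "((\<lambda>t. - (a t * (lam * g (u t)))) has_integral phi (deriv u y) - phi (deriv u x)) {x..y}"
  proof (rule fundamental_theorem_of_calculus_abs_cont[OF xy])
    show "abs_cont_on (\<lambda>t. phi (deriv u t)) x y"
      using sol by (simp add: is_solution_def locally_abs_cont_def)
    have "AE t in lebesgue. \<exists>d. ((\<lambda>s. phi (deriv u s)) has_real_derivative d) (at t) \<and> d + lam * a t * g (u t) = 0"
      using sol by (simp add: is_solution_def)
    then show "AE t in lebesgue. ((\<lambda>t. phi (deriv u t)) has_real_derivative - (a t * (lam * g (u t)))) (at t)"
    proof eventually_elim
      case (elim t)
      then obtain d where d: "((\<lambda>s. phi (deriv u s)) has_real_derivative d) (at t)" "d + lam * a t * g (u t) = 0"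
        by blast
      from d(2) have "d = - (a t * (lam * g (u t)))" by (simp add: algebra_simps)
      with d(1) show ?case by simp
    qed
  qed
  from has_integral_neg[OF this] show ?thesis by simp
qed

lemma solution_deriv_antimono:
  assumes sol: "is_solution a g lam u" and "lam > 0" and g: "\<And>t. g (u t) \<ge> 0"
    and a: "AE t in lebesgue. t \<in> {x..y} \<longrightarrow> a t \<ge> 0" and xy: "x \<le> y"
  shows "deriv u y \<le> deriv u x"
proof -
  have "0 \<le> phi (deriv u x) - phi (deriv u y)"
    by (rule has_integral_le_AE[OF has_integral_0 solution_flux[OF sol xy]])
       (use a in eventually_elim, use assms(2) g in auto)
  then show ?thesis
    using phi_inv_mono[of "phi (deriv u y)" "phi (deriv u x)"] solution_deriv_eq_phi_inv[OF sol] by simp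
qed

lemma solution_deriv_mono:
  assumes sol: "is_solution a g lam u" and "lam > 0" and g: "\<And>t. g (u t) \<ge> 0"
    and a: "AE t in lebesgue. t \<in> {x..y} \<longrightarrow> a t \<le> 0" and xy: "x \<le> y"
  shows "deriv u x \<le> deriv u y"
proof -
  have "phi (deriv u x) - phi (deriv u y) \<le> 0"
    by (rule has_integral_le_AE[OF solution_flux[OF sol xy] has_integral_0])
       (use a in eventually_elim, use assms(2) g in \<open>auto intro!: mult_nonpos_nonneg\<close>)
  then show ?thesis
    using phi_inv_mono[of "phi (deriv u x)" "phi (deriv u y)"] solution_deriv_eq_phi_inv[OF sol] by simp
qed

text \<open>
  The key estimate. The force integrated over the core of the interval equals the drop of \<open>phi (deriv u)\<close>
  across it. This drop is linear in the height \<open>u s\<close> because both end slopes are, whereas the force grows like the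
  power \<open>p\<close> of the height.
\<close>

lemma hump_height_estimate:
  assumes sol: "is_solution a g lam u" and lam: "lam > 0" and u_pos: "\<And>t. u t > 0"
    and a_nonneg: "AE t in lebesgue. t \<in> {\<sigma>..\<tau>} \<longrightarrow> a t \<ge> 0"
    and a_int: "a integrable_on {\<sigma> + 2 * \<rho>..\<tau> - 2 * \<rho>}"
    and \<rho>: "0 < \<rho>" "4 * \<rho> < \<tau> - \<sigma>"
    and k: "k > 0" and p: "p > 0" and g_low: "\<And>x. \<lbrakk>0 < x; x \<le> \<rho>\<rbrakk> \<Longrightarrow> k * x powr p \<le> g x"
    and g_pos: "\<And>x. x > 0 \<Longrightarrow> g x > 0"
    and s: "s \<in> {\<sigma>..\<tau>}" and max: "\<And>t. u t \<le> u s" and small: "u s \<le> \<rho>"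
  shows "lam * (u s powr p) * (k * (2 * \<rho> / (\<tau> - \<sigma>)) powr p * integral {\<sigma> + 2 * \<rho>..\<tau> - 2 * \<rho>} a)
     \<le> 2 / \<rho> * u s"
proof -
  define \<alpha> where "\<alpha> = \<sigma> + 2 * \<rho>"
  define \<beta> where "\<beta> = \<tau> - 2 * \<rho>"
  define q where "q = 2 * \<rho> / (\<tau> - \<sigma>)"
  have ab: "\<alpha> \<le> \<beta>" "\<sigma> \<le> \<alpha>" "\<beta> \<le> \<tau>" and q: "q > 0" using \<rho> by (auto simp: \<alpha>_def \<beta>_def q_def)
  have gu: "g (u t) \<ge> 0" for t using g_pos u_pos by (simp add: less_imp_le)
  have anti: "deriv u y \<le> deriv u x" if "\<sigma> \<le> x" "x \<le> y" "y \<le> \<tau>" for x y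
    by (rule solution_deriv_antimono[OF sol lam gu _ that(2)])
       (use a_nonneg in eventually_elim, use that in auto)
  have u_nonneg: "u t \<ge> 0" for t using u_pos less_imp_le by blast
  note hump = concave_hump_estimates[of u "deriv u" \<sigma> \<tau> \<rho> s, OF solution_has_derivative(1)[OF sol] anti u_nonneg \<rho> s max]
  have low: "k * (q * u s) powr p \<le> g (u t)" if "t \<in> {\<alpha>..\<beta>}" for t
  proof -
    have "(q * u s) powr p \<le> u t powr p"
      using hump(1)[of t] that q u_nonneg p unfolding \<alpha>_def \<beta>_def q_def[symmetric]
      by (intro powr_mono2) auto
    then have "k * (q * u s) powr p \<le> k * u t powr p" using k by (intro mult_left_mono) auto
    also have "\<dots> \<le> g (u t)" using g_low[of "u t"] u_pos max[of t] small by (meson order.trans)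
    finally show ?thesis .
  qed
  have "integral {\<alpha>..\<beta>} a * (lam * (k * (q * u s) powr p)) \<le> phi (deriv u \<alpha>) - phi (deriv u \<beta>)"
  proof (rule has_integral_le_AE[OF _ solution_flux[OF sol ab(1)]])
    show "((\<lambda>t. a t * (lam * (k * (q * u s) powr p))) has_integral
        integral {\<alpha>..\<beta>} a * (lam * (k * (q * u s) powr p))) {\<alpha>..\<beta>}"
      using a_int by (intro has_integral_mult_left) (auto simp: \<alpha>_def \<beta>_def)
    show "AE t in lebesgue. t \<in> {\<alpha>..\<beta>} \<longrightarrow> a t * (lam * (k * (q * u s) powr p)) \<le> a t * (lam * g (u t))"
      using a_nonneg
    proof eventually_elim
      case (elim t)
      then show ?case using low[of t] lam ab by (auto intro!: mult_left_mono)
    qed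
  qed
  also have "\<dots> \<le> 2 * (u s / (2 * \<rho>)) + 2 * (u s / (2 * \<rho>))"
  proof -
    have slope: "0 \<le> u s / (2 * \<rho>)" "u s / (2 * \<rho>) \<le> 1/2"
      using small \<rho> u_nonneg by (auto simp: field_simps)
    have "\<bar>deriv u t\<bar> < 1" for t using sol by (simp add: is_solution_def)
    then have lt: "-1 < deriv u \<alpha>" "-1 < - deriv u \<beta>" by (auto simp: abs_less_iff)
    have "phi (deriv u \<alpha>) \<le> 2 * (u s / (2 * \<rho>))"
      by (rule phi_le_twice) (use hump(2) slope lt in \<open>auto simp: \<alpha>_def\<close>)
    moreover have "phi (- deriv u \<beta>) \<le> 2 * (u s / (2 * \<rho>))"
      by (rule phi_le_twice) (use hump(3) slope lt in \<open>auto simp: \<beta>_def\<close>)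
    ultimately show ?thesis by (simp add: phi_minus)
  qed
  also have "\<dots> = 2 / \<rho> * u s" using \<rho> by simp
  finally have "integral {\<alpha>..\<beta>} a * (lam * (k * (q * u s) powr p)) \<le> 2 / \<rho> * u s" .
  moreover have "(q * u s) powr p = q powr p * u s powr p" using q u_nonneg by (simp add: powr_mult)
  ultimately show ?thesis by (simp add: \<alpha>_def \<beta>_def q_def mult.commute mult.left_commute mult.assoc)
qed

text \<open>
  From a maximum point \<open>s\<close> move left to the nearest point \<open>z\<close> of the closed set \<open>S\<close>. In between \<open>a \<le> 0\<close>, so
  \<open>deriv u\<close> is nondecreasing there; it vanishes at \<open>s\<close>, hence is nonpositive on the way, and \<open>z\<close> is a maximum point
  too. A translation by a multiple of \<open>T\<close> brings it into one of the given intervals.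
\<close>

lemma max_attained_on_nonneg_intervals:
  assumes T: "T > 0" and sol: "is_solution a g lam u" and per: "periodic_with T u" and lam: "lam > 0"
    and g: "\<And>t. g (u t) \<ge> 0" and m: "m \<ge> (1 :: nat)"
    and nontriv: "\<And>i. i \<in> {1..m} \<Longrightarrow> \<sigma> i < \<tau> i"
    and a_nonpos: "AE t in lebesgue. t \<notin> (\<Union>i\<in>{1..m}. saturation T {\<sigma> i..\<tau> i}) \<longrightarrow> a t \<le> 0"
  shows "\<exists>i\<in>{1..m}. \<exists>s\<in>{\<sigma> i..\<tau> i}. \<forall>t. u t \<le> u s"
proof -
  define S where "S = (\<Union>i\<in>{1..m}. saturation T {\<sigma> i..\<tau> i})"
  have closed: "closed S" unfolding S_def by (intro closed_UN) (auto simp: closed_saturation)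
  obtain s where max: "\<forall>t. u t \<le> u s"
    using periodic_attains_max[OF T per solution_continuous[OF sol]] by (elim bexE)
  have "\<exists>z\<in>S. u z = u s"
  proof -
    \<comment> \<open>\<open>S\<close> has points to the left of \<open>s\<close>, since it contains all translates of its first interval\<close>
    define P where "P = S \<inter> {..s}"
    have "P \<noteq> {}"
    proof -
      define k where "k = \<lfloor>(s - \<sigma> 1) / T\<rfloor>"
      have "of_int k \<le> (s - \<sigma> 1) / T" by (simp add: k_def)
      then have "\<sigma> 1 + of_int k * T \<le> s" using T by (simp add: field_simps)
      moreover have "\<sigma> 1 + of_int k * T \<in> S"
        using m nontriv[of 1] unfolding S_def saturation_def by force
      ultimately show ?thesis by (auto simp: P_def)
    qed
    moreover have "closed P" "bdd_above P" unfolding P_def using closed by auto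
    ultimately have "Sup P \<in> P" using closed_contains_Sup by blast
    define z where "z = Sup P"
    have z: "z \<in> S" "z \<le> s" using \<open>Sup P \<in> P\<close> by (auto simp: z_def P_def)
    have off: "x \<notin> S" if "z < x" "x \<le> s" for x
      using cSup_upper[of x P] \<open>bdd_above P\<close> that by (force simp: P_def z_def)
    have du_s: "deriv u s = 0"
      using DERIV_local_max[OF solution_has_derivative(1)[OF sol], of 1 s] max by auto
    have "deriv u x \<le> 0" if x: "z < x" "x < s" for x
    proof -
      have "AE t in lebesgue. t \<in> {x..s} \<longrightarrow> a t \<le> 0"
        using a_nonpos
      proof eventually_elim
        case (elim t)
        then show ?case using off[of t] x unfolding S_def by auto
      qed
      then show ?thesis using solution_deriv_mono[OF sol lam g, of x s] x du_s by auto
    qed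
    then have "u s \<le> u z"
    proof (cases "z = s")
      case False
      then have "z < s" using z by simp
      then obtain x where "z < x" "x < s" "u s - u z = (s - z) * deriv u x"
        using MVT2[of z s u "deriv u"] solution_has_derivative(1)[OF sol] by blast
      then show ?thesis
        using \<open>\<And>x. \<lbrakk>z < x; x < s\<rbrakk> \<Longrightarrow> deriv u x \<le> 0\<close>[of x] mult_nonneg_nonpos[of "s - z" "deriv u x"] by auto
    qed simp
    then show ?thesis using z max by (intro bexI[of _ z]) (auto intro: antisym)
  qed
  then obtain z where z: "z \<in> S" "u z = u s" by blast
  then obtain i t k where i: "i \<in> {1..m}" "t \<in> {\<sigma> i..\<tau> i}" "z = t + of_int k * T"
    unfolding S_def saturation_def by blast
  then have "u t = u s" using z(2) periodic_with_int[OF per, of t k] by simp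
  then have "\<forall>x. u x \<le> u t" using max by simp
  then show ?thesis using i(1,2) by blast
qed

text \<open>
  Both the maximum point, where the derivative vanishes, and a translate of \<open>t\<close> can be taken in \<open>{0..T}\<close>, so one
  integral over a single period bounds the change of \<open>phi (deriv u)\<close> between them.
\<close>

lemma solution_deriv_bound:
  assumes T: "T > 0" and sol: "is_solution a g lam u" and per: "periodic_with T u" and lam: "lam > 0"
    and a_int: "(\<lambda>t. \<bar>a t\<bar>) integrable_on {0..T}" and G: "\<And>t. \<bar>lam * g (u t)\<bar> \<le> G"
  shows "\<bar>deriv u t\<bar> \<le> G * integral {0..T} (\<lambda>t. \<bar>a t\<bar>)"
proof -
  obtain s where s: "s \<in> {0..T}" and max: "\<forall>t. u t \<le> u s"
    using periodic_attains_max[OF T per solution_continuous[OF sol]] by (elim bexE)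
  have du_s: "deriv u s = 0"
    using DERIV_local_max[OF solution_has_derivative(1)[OF sol], of 1 s] max by auto
  obtain k :: int where k: "t + of_int k * T \<in> {0..T}" using periodic_representative[OF T] .
  define r where "r = t + of_int k * T"
  have du_r: "deriv u r = deriv u t"
    unfolding r_def using periodic_with_int[OF periodic_with_deriv[OF solution_has_derivative(1)[OF sol] per]] .
  have G0: "G \<ge> 0" using G[of 0] by linarith
  have bound: "\<bar>phi (deriv u x) - phi (deriv u y)\<bar> \<le> G * integral {0..T} (\<lambda>t. \<bar>a t\<bar>)"
    if xy: "0 \<le> x" "x \<le> y" "y \<le> T" for x y
  proof -
    have sub: "{x..y} \<subseteq> {0..T}" using xy by auto
    have int: "(\<lambda>t. \<bar>a t\<bar>) integrable_on {x..y}" using integrable_on_subinterval[OF a_int sub] .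
    note I = solution_flux[OF sol xy(2)]
    have "norm (integral {x..y} (\<lambda>t. a t * (lam * g (u t)))) \<le> integral {x..y} (\<lambda>t. G * \<bar>a t\<bar>)"
    proof (rule Henstock_Kurzweil_Integration.integral_norm_bound_integral)
      show "(\<lambda>t. a t * (lam * g (u t))) integrable_on {x..y}" using I by blast
      show "(\<lambda>t. G * \<bar>a t\<bar>) integrable_on {x..y}" using int by (intro integrable_on_mult_right)
      fix t
      have "\<bar>a t\<bar> * \<bar>lam * g (u t)\<bar> \<le> \<bar>a t\<bar> * G" using G by (intro mult_left_mono) auto
      then show "norm (a t * (lam * g (u t))) \<le> G * \<bar>a t\<bar>" by (simp add: abs_mult mult.commute)
    qed
    also have "\<dots> = G * integral {x..y} (\<lambda>t. \<bar>a t\<bar>)" by simp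
    also have "\<dots> \<le> G * integral {0..T} (\<lambda>t. \<bar>a t\<bar>)"
      using integral_subset_le[OF sub int a_int] G0 by (intro mult_left_mono) auto
    finally show ?thesis using integral_unique[OF I] by simp
  qed
  have "\<bar>phi (deriv u r)\<bar> \<le> G * integral {0..T} (\<lambda>t. \<bar>a t\<bar>)"
    using bound[of r s] bound[of s r] s k du_s unfolding r_def[symmetric]
    by (cases "r \<le> s") (auto simp: phi_def)
  then show ?thesis
    using abs_phi_inv_le[of "phi (deriv u r)"] solution_deriv_eq_phi_inv[OF sol, of r] du_r by simp
qed

lemma solution_second_derivative:
  assumes sol: "is_solution a g lam u"
    and flux: "((\<lambda>t. - phi (deriv u t)) has_real_derivative a t * (lam * g (u t))) (at t)"
  shows "deriv u differentiable (at t)" and "\<bar>deriv (deriv u) t\<bar> \<le> \<bar>lam * g (u t)\<bar> * \<bar>a t\<bar>"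
proof -
  obtain D where D: "(phi_inv has_real_derivative D) (at (phi (deriv u t)))" "0 \<le> D" "D \<le> 1"
    by (rule phi_inv_has_derivative)
  have "((\<lambda>t. phi (deriv u t)) has_real_derivative - (a t * (lam * g (u t)))) (at t)"
    using DERIV_minus[OF flux] by simp
  from DERIV_chain2[OF D(1) this]
  have der: "(deriv u has_real_derivative D * - (a t * (lam * g (u t)))) (at t)"
    using solution_deriv_eq_phi_inv[OF sol] by simp
  then show "deriv u differentiable (at t)" by (auto simp: real_differentiable_def)
  have "\<bar>deriv (deriv u) t\<bar> = D * (\<bar>lam * g (u t)\<bar> * \<bar>a t\<bar>)"
    using DERIV_imp_deriv[OF der] D(2) by (simp add: abs_mult)
  also have "\<dots> \<le> 1 * (\<bar>lam * g (u t)\<bar> * \<bar>a t\<bar>)" using D(3) by (intro mult_right_mono) auto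
  finally show "\<bar>deriv (deriv u) t\<bar> \<le> \<bar>lam * g (u t)\<bar> * \<bar>a t\<bar>" by simp
qed

text \<open>
  Ensures that parameters above the threshold are positive, which is what turns the sign of \<open>a\<close> into concavity
  or convexity of the solution.
\<close>

lemma lambda_star_nonneg:
  assumes m: "m \<ge> 1" and rho: "admissible_rho a m \<sigma> \<tau> \<rho>" and g: "\<And>x. x > 0 \<Longrightarrow> g x > 0"
  shows "0 \<le> lambda_star a g m \<sigma> \<tau> \<rho>"
proof -
  have "1 \<in> {1..m}" using m by simp
  then have \<rho>: "\<rho> > 0" "\<rho> < (\<tau> 1 - \<sigma> 1) / 4" and A: "integral {\<sigma> 1 + 2 * \<rho>..\<tau> 1 - 2 * \<rho>} a > 0"
    using rho unfolding admissible_rho_def by blast+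
  define l where "l = 2 * \<rho>\<^sup>2 / (\<tau> 1 - \<sigma> 1)"
  have "0 < l" using \<rho> by (simp add: l_def)
  have "\<rho> * (2 * \<rho>) \<le> \<rho> * (\<tau> 1 - \<sigma> 1)" using \<rho> by (intro mult_left_mono) auto
  then have "l \<le> \<rho>" using \<rho> by (simp add: l_def pos_divide_le_eq power2_eq_square)
  have "0 \<le> (INF u\<in>{l..\<rho>}. g u)"
    using \<open>l \<le> \<rho>\<close> \<open>0 < l\<close> by (intro cINF_greatest) (auto intro!: less_imp_le[OF g])
  moreover have "0 \<le> phi (1/2)" by (simp add: phi_def power2_eq_square)
  ultimately have "0 \<le> 2 * phi (1/2) / ((INF u\<in>{l..\<rho>}. g u) * integral {\<sigma> 1 + 2 * \<rho>..\<tau> 1 - 2 * \<rho>} a)"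
    using A by simp
  also have "\<dots> \<le> lambda_star a g m \<sigma> \<tau> \<rho>"
    unfolding lambda_star_def l_def using \<open>1 \<in> {1..m}\<close> by (intro Max_ge imageI) auto
  finally show ?thesis .
qed

text \<open>
  The supremum of an unbounded range would be unspecified, so even nonnegativity needs the bound.
\<close>

lemma sup_norm_le:
  assumes "\<And>t. \<bar>f t\<bar> \<le> B"
  shows "0 \<le> sup_norm f" "sup_norm f \<le> B" "\<bar>f t\<bar> \<le> sup_norm f"
proof -
  have bdd: "bdd_above (range (\<lambda>t. \<bar>f t\<bar>))" using assms by (auto intro!: bdd_aboveI)
  have upper: "\<bar>f t\<bar> \<le> sup_norm f" for t
    unfolding sup_norm_def by (rule cSUP_upper[OF _ bdd]) simp
  then show "\<bar>f t\<bar> \<le> sup_norm f" .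
  show "0 \<le> sup_norm f" using upper[of 0] by linarith
  show "sup_norm f \<le> B" unfolding sup_norm_def using assms by (intro cSUP_least) auto
qed

section \<open>Asymptotics of small solutions\<close>

theorem theorem4p2:
  fixes T :: real and a g :: "real \<Rightarrow> real"
    and m :: nat and \<sigma> \<tau> :: "nat \<Rightarrow> real"
    and p c\<^sub>p \<rho> :: real
    and u :: "real \<Rightarrow> real \<Rightarrow> real"
  assumes T_pos: "T > 0"
    and a_int: "locally_integrable a"
    and a_per: "periodic_with T a"
    and a_mean: "integral {0..T} a < 0"
    and m_pos: "m \<ge> 1"
    and I_nontriv: "\<And>i. i \<in> {1..m} \<Longrightarrow> \<sigma> i < \<tau> i"
    and I_disj: "disjoint_family_on (\<lambda>i. saturation T {\<sigma> i..\<tau> i}) {1..m}"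
    and a_nonneg: "\<And>i. i \<in> {1..m} \<Longrightarrow> AE t in lebesgue. t \<in> {\<sigma> i..\<tau> i} \<longrightarrow> a t \<ge> 0"
    and a_nonzero: "\<And>i. i \<in> {1..m} \<Longrightarrow> \<not> (AE t in lebesgue. t \<in> {\<sigma> i..\<tau> i} \<longrightarrow> a t = 0)"
    and a_nonpos: "AE t in lebesgue. t \<notin> (\<Union>i\<in>{1..m}. saturation T {\<sigma> i..\<tau> i}) \<longrightarrow> a t \<le> 0"
    and g_cont: "continuous_on {0..} g"
    and g_zero: "g 0 = 0"
    and g_pos: "\<And>x. x > 0 \<Longrightarrow> g x > 0"
    and g_cases:
      "(((\<lambda>x. g x / x) \<longlongrightarrow> 0) (at_right 0) \<and>
        ((\<lambda>(x, \<omega>). g (\<omega> * x) / g x) \<longlongrightarrow> 1) (at (0, 1) within {0<..} \<times> {0<..}))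
       \<or>
       (\<exists>\<epsilon>>0. \<exists>g'. (\<forall>x\<in>{0..<\<epsilon>}. (g has_real_derivative g' x) (at x within {0..<\<epsilon>})) \<and>
          continuous_on {0..<\<epsilon>} g' \<and> g' 0 = 0)"
    and g_mono: "\<exists>\<delta>>0. mono_on {0<..<\<delta>} g"
    and p_gt_1: "p > 1"
    and c_pos: "c\<^sub>p > 0"
    and g_lim: "((\<lambda>x. g x / x powr p) \<longlongrightarrow> c\<^sub>p) (at_right 0)"
    and rho: "admissible_rho a m \<sigma> \<tau> \<rho>"
    and u_sol: "\<And>lam. lam > lambda_star a g m \<sigma> \<tau> \<rho> \<Longrightarrow> positive_periodic_solution T a g lam (u lam)"
    and u_small: "\<And>lam. lam > lambda_star a g m \<sigma> \<tau> \<rho> \<Longrightarrow> sup_norm (u lam) < \<rho>"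
  shows "((\<lambda>lam. C1_norm (u lam)) \<longlongrightarrow> 0) at_top \<and>
    (\<exists>C>0. AE t in lebesgue. \<forall>lam > lambda_star a g m \<sigma> \<tau> \<rho>.
       deriv (u lam) differentiable (at t) \<and> \<bar>deriv (deriv (u lam)) t\<bar> \<le> C * \<bar>a t\<bar>)"
proof -
  define \<Lambda> where "\<Lambda> = lambda_star a g m \<sigma> \<tau> \<rho>"
  define q where "q i = 2 * \<rho> / (\<tau> i - \<sigma> i)" for i
  define A where "A i = integral {\<sigma> i + 2 * \<rho>..\<tau> i - 2 * \<rho>} a" for i
  define A0 where "A0 = integral {0..T} (\<lambda>t. \<bar>a t\<bar>)"
  have \<rho>: "\<rho> > 0" using rho by (simp add: admissible_rho_def)
  have rho_i: "\<rho> < (\<tau> i - \<sigma> i) / 4" "A i > 0" if "i \<in> {1..m}" for i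
    using rho that unfolding admissible_rho_def A_def by blast+
  have \<rho>_lt: "4 * \<rho> < \<tau> i - \<sigma> i" and A_pos: "A i > 0" if "i \<in> {1..m}" for i
    using rho_i[OF that] by simp_all
  have a_integrable: "a integrable_on {x..y}" "(\<lambda>t. \<bar>a t\<bar>) integrable_on {x..y}" for x y
    using a_int unfolding locally_integrable_def absolutely_integrable_on_def by auto
  have A0: "A0 \<ge> 0" unfolding A0_def by (intro integral_nonneg a_integrable) auto
  have lam_pos: "lam > 0" if "lam > \<Lambda>" for lam
    using lambda_star_nonneg[OF m_pos rho, of g] g_pos that by (simp add: \<Lambda>_def)
  have "\<exists>k>0. \<exists>c>0. \<forall>x. 0 < x \<and> x \<le> \<rho> \<longrightarrow> k * x powr p \<le> g x \<and> g x \<le> c * x powr p"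
    by (rule power_growth_two_sided[OF g_cont _ g_lim c_pos \<rho>]) (rule g_pos)
  then obtain k c where k: "k > 0" and c: "c > 0"
    and growth: "\<forall>x. 0 < x \<and> x \<le> \<rho> \<longrightarrow> k * x powr p \<le> g x \<and> g x \<le> c * x powr p"
    by (elim exE conjE)
  \<comment> \<open>the coefficient of \<open>lam * M powr p\<close> in the estimate over the interval \<open>i\<close>\<close>
  define B where "B i = k * q i powr p * A i" for i
  define K where "K = Max ((\<lambda>i. 2 / \<rho> / B i) ` {1..m})"
  have q_pos: "q i > 0" if "i \<in> {1..m}" for i using \<rho> \<rho>_lt[OF that] by (simp add: q_def)
  have B_pos: "B i > 0" if "i \<in> {1..m}" for i
    using k q_pos[OF that] A_pos[OF that] by (simp add: B_def)
  have K_ge: "2 / \<rho> / B i \<le> K" if "i \<in> {1..m}" for i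
    unfolding K_def using that by (intro Max_ge) auto
  have K: "K > 0"
    using K_ge[of 1] B_pos[of 1] m_pos \<rho> by (auto intro: less_le_trans[rotated])
  have sol: "is_solution a g lam (u lam)" and per: "periodic_with T (u lam)" and pos: "u lam t > 0"
    if "lam > \<Lambda>" for lam t
    using u_sol that by (auto simp: positive_periodic_solution_def \<Lambda>_def)
  have height: "\<exists>s. (\<forall>t. u lam t \<le> u lam s) \<and> u lam s < \<rho> \<and> lam * u lam s powr p \<le> K * u lam s"
    if lam: "lam > \<Lambda>" for lam
  proof -
    have "\<exists>i\<in>{1..m}. \<exists>s\<in>{\<sigma> i..\<tau> i}. \<forall>t. u lam t \<le> u lam s"
      by (rule max_attained_on_nonneg_intervals[OF T_pos sol[OF lam] per[OF lam] lam_pos[OF lam]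
            less_imp_le[OF g_pos[OF pos[OF lam]]] m_pos _ a_nonpos]) (rule I_nontriv)
    then obtain i s where i: "i \<in> {1..m}" and s: "s \<in> {\<sigma> i..\<tau> i}" and max: "\<forall>t. u lam t \<le> u lam s"
      by (elim bexE)
    have "\<bar>u lam t\<bar> \<le> u lam s" for t using max[rule_format, of t] pos[OF lam, of t] by simp
    from sup_norm_le(3)[where f = "u lam" and t = s, OF this] have small: "u lam s < \<rho>"
      using u_small[of lam] lam pos[OF lam, of s] by (simp add: \<Lambda>_def)
    have "lam * u lam s powr p * B i \<le> 2 / \<rho> * u lam s"
      unfolding B_def q_def A_def
      by (rule hump_height_estimate[OF sol[OF lam] lam_pos[OF lam] pos[OF lam] a_nonneg[OF i]
            a_integrable(1) \<rho> \<rho>_lt[OF i] k _ _ g_pos s max[rule_format] less_imp_le[OF small]])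
         (use p_gt_1 growth in auto)
    then have "lam * u lam s powr p \<le> 2 / \<rho> * u lam s / B i"
      using B_pos[OF i] by (simp only: pos_le_divide_eq)
    also have "\<dots> = 2 / \<rho> / B i * u lam s" by simp
    also have "\<dots> \<le> K * u lam s" using K_ge[OF i] pos[OF lam, of s] by (intro mult_right_mono) auto
    finally show ?thesis using max small by blast
  qed
  then obtain s where max: "\<And>lam t. lam > \<Lambda> \<Longrightarrow> u lam t \<le> u lam (s lam)"
    and small: "\<And>lam. lam > \<Lambda> \<Longrightarrow> u lam (s lam) < \<rho>"
    and rate: "\<And>lam. lam > \<Lambda> \<Longrightarrow> lam * u lam (s lam) powr p \<le> K * u lam (s lam)"
    by metis
  define M where "M lam = u lam (s lam)" for lam
  have M_pos: "M lam > 0" if "lam > \<Lambda>" for lam using pos[OF that] by (simp add: M_def)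
  have force_le: "\<bar>lam * g (u lam t)\<bar> \<le> c * K * M lam" if lam: "lam > \<Lambda>" for lam t
  proof -
    have "g (u lam t) \<le> c * u lam t powr p"
      using growth[rule_format, of "u lam t"] pos[OF lam, of t] max[OF lam, of t] small[OF lam] by simp
    also have "\<dots> \<le> c * M lam powr p"
      using max[OF lam, of t] pos[OF lam, of t] p_gt_1 c
      by (intro mult_left_mono powr_mono2) (auto simp: M_def)
    finally have "lam * g (u lam t) \<le> lam * (c * M lam powr p)"
      using lam_pos[OF lam] by (intro mult_left_mono) auto
    also have "\<dots> = c * (lam * M lam powr p)" by simp
    also have "\<dots> \<le> c * (K * M lam)"
      using rate[OF lam] c unfolding M_def by (intro mult_left_mono) auto
    finally show ?thesis
      using lam_pos[OF lam] g_pos[OF pos[OF lam, of t]] by (simp add: mult.assoc abs_mult)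
  qed
  \<comment> \<open>\<open>1\<close> accounts for the function itself, the other summand for its derivative\<close>
  define C where "C = 1 + c * K * A0"
  have C: "C > 0" unfolding C_def using c K A0 by (intro add_pos_nonneg) auto
  have C1_le: "0 \<le> C1_norm (u lam) \<and> C1_norm (u lam) \<le> C * M lam" if lam: "lam > \<Lambda>" for lam
  proof -
    have 1: "\<bar>u lam t\<bar> \<le> M lam" for t
      using max[OF lam, of t] pos[OF lam, of t] by (simp add: M_def)
    have 2: "\<bar>deriv (u lam) t\<bar> \<le> c * K * M lam * A0" for t
      unfolding A0_def
      by (rule solution_deriv_bound[OF T_pos sol[OF lam] per[OF lam] lam_pos[OF lam]
            a_integrable(2) force_le[OF lam]])
    show ?thesis
      using sup_norm_le(1,2)[where f = "u lam", OF 1] sup_norm_le(1,2)[where f = "deriv (u lam)", OF 2]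
      by (simp add: C1_norm_def C_def algebra_simps)
  qed
  have "((\<lambda>lam. C1_norm (u lam)) \<longlongrightarrow> 0) at_top"
  proof (rule tendstoI)
    fix e :: real assume e: "e > 0"
    define \<eta> where "\<eta> = e / C"
    have \<eta>: "\<eta> > 0" using e C by (simp add: \<eta>_def)
    \<comment> \<open>beyond this threshold a height of at least \<open>\<eta>\<close> would violate the rate \<open>lam * M powr (p - 1) \<le> K\<close>\<close>
    have "eventually (\<lambda>lam. lam > max \<Lambda> (K / \<eta> powr (p - 1))) at_top"
      by (rule eventually_gt_at_top)
    then show "eventually (\<lambda>lam. dist (C1_norm (u lam)) 0 < e) at_top"
    proof eventually_elim
      case (elim lam)
      then have lam: "lam > \<Lambda>" by simp
      have "M lam < \<eta>"
      proof (rule ccontr)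
        assume "\<not> M lam < \<eta>"
        then have "\<eta> powr (p - 1) \<le> M lam powr (p - 1)"
          using p_gt_1 \<eta> by (intro powr_mono2) auto
        then have "lam * \<eta> powr (p - 1) \<le> lam * M lam powr (p - 1)"
          using lam_pos[OF lam] by (intro mult_left_mono) auto
        moreover have "lam * M lam powr (p - 1) \<le> K"
          using rate[OF lam] M_pos[OF lam]
          by (simp add: M_def[symmetric] powr_diff pos_divide_le_eq)
        moreover have "K < lam * \<eta> powr (p - 1)"
          using elim \<eta> by (simp add: pos_divide_less_eq)
        ultimately show False by linarith
      qed
      then have "C * M lam < e" using C by (simp add: \<eta>_def pos_less_divide_eq mult.commute)
      then show ?case using C1_le[OF lam] by simp
    qed
  qed
  moreover have "AE t in lebesgue. \<forall>lam > \<Lambda>.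
       deriv (u lam) differentiable (at t) \<and> \<bar>deriv (deriv (u lam)) t\<bar> \<le> (c * K * \<rho>) * \<bar>a t\<bar>"
    using AE_derivative_of_weighted_primitive[OF a_int]
  proof eventually_elim
    case (elim t)
    show ?case
    proof (intro allI impI)
      fix lam assume lam: "lam > \<Lambda>"
      have weight: "continuous_on UNIV (\<lambda>t. lam * g (u lam t))"
        by (intro continuous_intros continuous_on_compose2[OF g_cont solution_continuous[OF sol[OF lam]]])
           (use pos[OF lam] less_imp_le in auto)
      have primitive: "\<forall>x y. x \<le> y \<longrightarrow> ((\<lambda>t. a t * (lam * g (u lam t))) has_integral
          - phi (deriv (u lam) y) - - phi (deriv (u lam) x)) {x..y}"
        using solution_flux[OF sol[OF lam]] by simp
      have flux: "((\<lambda>t. - phi (deriv (u lam) t)) has_real_derivative a t * (lam * g (u lam t))) (at t)"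
        using elim[THEN spec[where x = "\<lambda>t. lam * g (u lam t)"],
            THEN spec[where x = "\<lambda>t. - phi (deriv (u lam) t)"]] weight primitive by blast
      have "\<bar>lam * g (u lam t)\<bar> \<le> c * K * M lam" by (rule force_le[OF lam])
      also have "\<dots> \<le> c * K * \<rho>"
        using small[OF lam] c K by (intro mult_left_mono) (auto simp: M_def)
      finally have "\<bar>lam * g (u lam t)\<bar> * \<bar>a t\<bar> \<le> c * K * \<rho> * \<bar>a t\<bar>" by (intro mult_right_mono) auto
      then show "deriv (u lam) differentiable (at t) \<and> \<bar>deriv (deriv (u lam)) t\<bar> \<le> c * K * \<rho> * \<bar>a t\<bar>"
        using solution_second_derivative[OF sol[OF lam] flux] by linarith
    qed
  qed
  moreover have "c * K * \<rho> > 0" using c K \<rho> by simp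
  ultimately show ?thesis unfolding \<Lambda>_def by blast
qed

end
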